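(* For every integer $d\geq 2$ and every integer $n\geq (30d)^{2d^2}$, $$1<\frac{\log p_d(n)}{n^{1-\frac{1}{d}}}<7200.$$
   Context: Let $\mathbb{Z}_+=\{0,1,2,\dots\}$. A set $S\subset\mathbb{Z}_+^d$ is a lower set (downward closed set) if whenever $\mathbf{x}=(x_1,\dots,x_d)\in S$ and $\mathbf{x}'\in\mathbb{Z}_+^d$ satisfies $x'_i\leq x_i$ for all $1\leq i\leq d$, then $\mathbf{x}'\in S$. For positive integers $d,n$, $p_d(n)$ denotes the number of lower sets in $\mathbb{Z}_+^d$ with exactly $n$ points (equivalently, the number of $(d-1)$-dimensional integer partitions of $n$). $\log$ is the natural logarithm. *)

theory Defs
  imports Complex_Main
begin

text \<open>Points of Z_+^d are represented as functions nat => nat vanishing outside {0..<d}.\<close>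
definition lattice_pts :: "nat \<Rightarrow> (nat \<Rightarrow> nat) set" where
  "lattice_pts d = {x. \<forall>i\<ge>d. x i = 0}"

definition is_lower_set :: "nat \<Rightarrow> (nat \<Rightarrow> nat) set \<Rightarrow> bool" where
  "is_lower_set d S \<longleftrightarrow> S \<subseteq> lattice_pts d \<and>
     (\<forall>x\<in>S. \<forall>x'\<in>lattice_pts d. (\<forall>i<d. x' i \<le> x i) \<longrightarrow> x' \<in> S)"

definition p :: "nat \<Rightarrow> nat \<Rightarrow> nat" where
  "p d n = card {S. is_lower_set d S \<and> finite S \<and> card S = n}"

end

theory Submission
  imports Defs "HOL-Analysis.Analysis"
begin

text \<open>
  Upper bound. Cut a lower set $S$ of size $n$ into two-dimensional slices (all but two coordinates
  fixed). Each slice is a Young diagram, and there are at most $\exp(10\sqrt t)$ of these with $t$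
  cells, so it suffices to cover $S$ by slices whose square roots of sizes sum to
  $O(n^{1-1/d})$ with an absolute constant; naming the $O_d(n^{1-2/d})$ slices is cheap because $n$
  is huge compared with $d$.
  Let $m \approx n^{1/d}/16$. For a threshold $M = 4^l m$, group the points by the set $K$ of
  coordinates that are at least $M$. If $|K| \geq d/(6\cdot 2^l)$, slice the group along the two
  directions in $K$ with the smallest projections. A slice with $r$ rows and $c$ columns has
  $\sqrt t \leq (r+c)/2$, the projections of all groups in direction $i$ have total size at most
  $n/M$, and averaging over $K$ only loses the factor $d/|K|$; the costs $9\cdot 2^{-l}n/m$ sum
  to $18n/m$. The points left over have, apart from their largest coordinate, so few large coordinates
  that only $2^d(2m)^{d-2}$ slices are needed, and Cauchy--Schwarz bounds their cost.

  Lower bound. Subgraphs of functions $2(k-|y|)+\varepsilon(y)$ on a simplex in $d-1$ variables, with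
  $\varepsilon(y)\in\{0,1,2\}$ arbitrary, are lower sets.
\<close>

section \<open>Counting Young diagrams\<close>

text \<open>The difficulty is a constant that does not grow with d. Slicing in two fixed directions
  works by Cauchy--Schwarz only if about n^((d-2)/d) slices suffice, and an elongated set needs far
  more; choosing two good directions among K instead loses a factor d/|K|. The scales balance the
  two. At level l the loss 6*2^l meets the threshold 4^l, so costs decay like 2^-l. A point that no
  level handles, once its largest coordinate is removed, has at most d/(6*2^l) coordinates above the
  l-th threshold, hence at most d/3 crossings of thresholds in all. With weight 1/8 per crossing the
  values of one coordinate have a summable weight, since the blocks between thresholds grow only by
  a factor 4, and d/3 crossings cost only 8^(d/3) = 2^d.

  In the lower bound, slope 1 with two values per point would give for d = 2 only the leading
  constant sqrt 2 * ln 2 < 1. Slope 2 with three values gives ln 3 > 1 there, and at least as much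
  in every dimension.\<close>

definition young :: "(nat \<times> nat) set \<Rightarrow> bool" where
  "young T \<longleftrightarrow> (\<forall>a b a' b'. (a, b) \<in> T \<longrightarrow> a' \<le> a \<longrightarrow> b' \<le> b \<longrightarrow> (a', b') \<in> T)"

lemma youngD: "young T \<Longrightarrow> (a, b) \<in> T \<Longrightarrow> a' \<le> a \<Longrightarrow> b' \<le> b \<Longrightarrow> (a', b') \<in> T"
  unfolding young_def by blast

lemma young_subset_square:
  assumes "young T" "finite T"
  shows "T \<subseteq> {..<card T} \<times> {..<card T}"
proof
  fix x assume "x \<in> T"
  obtain a b where x: "x = (a, b)" by (cases x)
  with \<open>x \<in> T\<close> have ab: "(a, b) \<in> T" by simp
  have "(\<lambda>c. (c, b)) ` {..a} \<subseteq> T" and "(\<lambda>c. (a, c)) ` {..b} \<subseteq> T"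
    using youngD[OF assms(1) ab] by auto
  then have "card ((\<lambda>c. (c, b)) ` {..a}) \<le> card T" "card ((\<lambda>c. (a, c)) ` {..b}) \<le> card T"
    using assms(2) by (auto intro: card_mono)
  then show "x \<in> {..<card T} \<times> {..<card T}"
    unfolding x by (simp add: card_image inj_on_def)
qed

text \<open>Splitting off a full bottom row gives the recursion of the generating function
  $\prod_{k\leq s} 1/(1-q^k)$, evaluated below at $q = s/(s+1)$ with $s \approx \sqrt t$.\<close>
definition youngs_within :: "nat \<Rightarrow> nat \<Rightarrow> (nat \<times> nat) set set" where
  "youngs_within s t = {T. young T \<and> finite T \<and> card T = t \<and> T \<subseteq> {..<s} \<times> UNIV}"

lemma finite_youngs_card: "finite {T. young T \<and> finite T \<and> card T = t}"
proof (rule finite_subset)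
  show "{T. young T \<and> finite T \<and> card T = t} \<subseteq> Pow ({..<t} \<times> {..<t})"
    using young_subset_square by blast
qed simp

lemma finite_youngs_within [simp]: "finite (youngs_within s t)"
  by (rule finite_subset[OF _ finite_youngs_card[of t]]) (auto simp: youngs_within_def)

lemma youngs_within_Suc_subset:
  "youngs_within (Suc s) t \<subseteq> youngs_within s t \<union>
     (if Suc s \<le> t then (\<lambda>T. {..s} \<times> {0} \<union> map_prod id Suc ` T) ` youngs_within (Suc s) (t - Suc s)
      else {})"
proof
  fix T assume "T \<in> youngs_within (Suc s) t"
  then have T: "young T" "finite T" "card T = t" "T \<subseteq> {..<Suc s} \<times> UNIV"
    by (auto simp: youngs_within_def)
  show "T \<in> youngs_within s t \<union>
     (if Suc s \<le> t then (\<lambda>T. {..s} \<times> {0} \<union> map_prod id Suc ` T) ` youngs_within (Suc s) (t - Suc s)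
      else {})"
  \<comment> \<open>If \<open>(s, 0)\<close> is missing, no cell has first coordinate s. If it is
    present, row 0 is full with s + 1 cells, and \<open>T'\<close> is what remains after deleting it
    and moving down by one.\<close>
  proof (cases "(s, 0) \<in> T")
    case False
    have "a < s" if "(a, b) \<in> T" for a b
    proof (rule ccontr)
      assume "\<not> a < s"
      with that T(4) have "a = s" by auto
      with youngD[OF T(1) that, of s 0] False show False by simp
    qed
    then have "T \<in> youngs_within s t"
      using T by (auto simp: youngs_within_def)
    then show ?thesis by simp
  next
    case True
    define T' where "T' = map_prod id Suc -` T"
    have inj: "inj (map_prod (id :: nat \<Rightarrow> nat) Suc)" by (simp add: prod.inj_map)
    have eq: "T = {..s} \<times> {0} \<union> map_prod id Suc ` T'"
    proof (intro equalityI subsetI)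
      fix x assume x: "x \<in> T"
      obtain a b where ab: "x = (a, b)" by (cases x)
      show "x \<in> {..s} \<times> {0} \<union> map_prod id Suc ` T'"
      proof (cases b)
        case 0 then show ?thesis using x T(4) ab by auto
      next
        case (Suc c)
        then have "x = map_prod id Suc (a, c)" "(a, c) \<in> T'" using x ab by (auto simp: T'_def)
        then show ?thesis by blast
      qed
    next
      fix x assume "x \<in> {..s} \<times> {0} \<union> map_prod id Suc ` T'"
      then show "x \<in> T" using youngD[OF T(1) True] by (auto simp: T'_def)
    qed
    have fin: "finite T'" unfolding T'_def using T(2) inj by (rule finite_vimageI)
    have "card T = card ({..s} \<times> {0::nat}) + card (map_prod id Suc ` T')"
      by (subst eq, rule card_Un_disjoint) (use fin in auto)
    also have "\<dots> = Suc s + card T'"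
      by (simp add: card_image inj_on_subset[OF inj subset_UNIV] card_cartesian_product)
    finally have c: "Suc s \<le> t" "card T' = t - Suc s" using T(3) by auto
    have "young T'" using T(1) unfolding young_def T'_def by simp
    moreover have "T' \<subseteq> {..<Suc s} \<times> UNIV" using T(4) by (auto simp: T'_def)
    ultimately have "T' \<in> youngs_within (Suc s) (t - Suc s)"
      using fin c by (simp add: youngs_within_def)
    then show ?thesis using eq c(1) by auto
  qed
qed

lemma card_youngs_within_Suc_le:
  "card (youngs_within (Suc s) t) \<le> card (youngs_within s t) +
     (if Suc s \<le> t then card (youngs_within (Suc s) (t - Suc s)) else 0)"
proof -
  let ?f = "\<lambda>T. {..s} \<times> {0} \<union> map_prod id Suc ` T"
  let ?B = "if Suc s \<le> t then ?f ` youngs_within (Suc s) (t - Suc s) else {}"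
  have "card (youngs_within (Suc s) t) \<le> card (youngs_within s t \<union> ?B)"
    by (rule card_mono[OF _ youngs_within_Suc_subset]) auto
  also have "\<dots> \<le> card (youngs_within s t) + card ?B" by (rule card_Un_le)
  also have "card ?B \<le> (if Suc s \<le> t then card (youngs_within (Suc s) (t - Suc s)) else 0)"
    by (auto intro: card_image_le)
  finally show ?thesis by simp
qed

text \<open>A coefficient of a power series with nonnegative coefficients, times q^t, is at most the
  value of the series. The induction replaces the series: multiplied by the product and q^t, the two
  terms of the recursion are at most 1 - q^(s+1) and q^(s+1). The second term keeps s and lowers t,
  hence the inner induction on t.\<close>

lemma card_youngs_within_le:
  fixes q :: real
  assumes q: "0 < q" "q < 1"
  shows "real (card (youngs_within s t)) * (\<Prod>k=1..s. 1 - q ^ k) * q ^ t \<le> 1"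
proof (induction s arbitrary: t)
  case 0
  have "youngs_within 0 t \<subseteq> {{}}" by (auto simp: youngs_within_def)
  then have "card (youngs_within 0 t) \<le> card {{} :: (nat \<times> nat) set}" by (intro card_mono) auto
  then have "real (card (youngs_within 0 t)) * q ^ t \<le> 1 * 1"
    using q by (intro mult_mono) (auto simp: power_le_one)
  then show ?case by simp
next
  case (Suc s)
  show ?case
  proof (induction t rule: less_induct)
    case (less t)
    define P where "P = (\<Prod>k=1..s. 1 - q ^ k)"
    define Q where "Q = q ^ Suc s"
    have Q: "0 \<le> Q" "Q \<le> 1" using q power_le_one[of q "Suc s"] unfolding Q_def by auto
    have P: "P \<ge> 0" unfolding P_def using q by (intro prod_nonneg) (auto simp: power_le_one)
    have PS: "(\<Prod>k=1..Suc s. 1 - q ^ k) = P * (1 - Q)" by (simp add: P_def Q_def)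
    define X where "X = real (if Suc s \<le> t then card (youngs_within (Suc s) (t - Suc s)) else 0)"
    have X: "X * (P * (1 - Q)) * q ^ t \<le> Q"
    proof (cases "Suc s \<le> t")
      case True
      have "q ^ t = q ^ (t - Suc s) * Q" unfolding Q_def by (metis True le_add_diff_inverse2 power_add)
      moreover have "real (card (youngs_within (Suc s) (t - Suc s))) * (P * (1 - Q)) * q ^ (t - Suc s) \<le> 1"
        using less.IH[of "t - Suc s"] True PS by simp
      then have "(real (card (youngs_within (Suc s) (t - Suc s))) * (P * (1 - Q)) * q ^ (t - Suc s)) * Q \<le> 1 * Q"
        using Q by (intro mult_right_mono)
      ultimately show ?thesis using True by (simp add: X_def mult_ac)
    qed (use Q in \<open>simp add: X_def\<close>)
    have "real (card (youngs_within (Suc s) t)) \<le> real (card (youngs_within s t)) + X"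
      using card_youngs_within_Suc_le[of s t] unfolding X_def by linarith
    then have "real (card (youngs_within (Suc s) t)) * (P * (1 - Q)) * q ^ t \<le>
        (real (card (youngs_within s t)) + X) * (P * (1 - Q)) * q ^ t"
      using P Q q by (intro mult_right_mono) auto
    also have "\<dots> = (real (card (youngs_within s t)) * P * q ^ t) * (1 - Q) + X * (P * (1 - Q)) * q ^ t"
      by (simp add: algebra_simps)
    also have "\<dots> \<le> 1 * (1 - Q) + Q"
      using Suc.IH[of t] Q X by (intro add_mono mult_right_mono) (auto simp: P_def)
    finally show ?case unfolding PS by simp
  qed
qed

text \<open>The product of (s + k)/k over k \<le> j is the binomial coefficient (s + j choose j); at
  j = s it is the central one.\<close>

lemma prod_one_plus_le_four_pow:
  fixes s :: nat
  shows "(\<Prod>k=1..s. 1 + real s / real k) \<le> 4 ^ s"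
proof -
  have "(\<Prod>k=1..j. 1 + real s / real k) = real ((s + j) choose j)" for j
  proof (induction j)
    case (Suc j)
    have "real (Suc j) * real ((s + Suc j) choose Suc j) = real (s + Suc j) * real ((s + j) choose j)"
      using Suc_times_binomial_eq[of "s + j" j]
      by (metis add_Suc_right mult.commute of_nat_mult)
    then show ?case using Suc by (simp add: field_simps)
  qed simp
  moreover have "real ((s + s) choose s) \<le> 2 ^ (s + s)"
    using binomial_le_pow2[of "s + s" s] by (metis of_nat_le_iff of_nat_numeral of_nat_power)
  moreover have "(2::real) ^ (s + s) = 4 ^ s" by (simp add: power_add flip: power_mult_distrib)
  ultimately show ?thesis by simp
qed

lemma sum_inverse_squares_le:
  assumes "0 < s"
  shows "(\<Sum>k=Suc s..<s + j. 1 / (real k)\<^sup>2) \<le> 1 / real s"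
proof -
  have "(\<Sum>k=Suc s..<Suc s + j. 1 / (real k)\<^sup>2) \<le> 1 / real s - 1 / real (s + j)" for j
  proof (induction j)
    case (Suc j)
    have "1 / (real (Suc s + j))\<^sup>2 \<le> 1 / real (s + j) - 1 / real (s + Suc j)"
    proof -
      define x where "x = real (s + j)"
      have x: "x > 0" using assms by (simp add: x_def)
      have "1 / (x + 1)\<^sup>2 \<le> 1 / (x * (x + 1))"
        using x by (intro divide_left_mono) (auto simp: power2_eq_square)
      also have "\<dots> = 1 / x - 1 / (x + 1)" using x by (simp add: field_simps)
      finally show ?thesis by (simp add: x_def add_ac)
    qed
    then show ?case using Suc by simp
  qed simp
  note * = this[of "j - 1"]
  have "(\<Sum>k=Suc s..<s + j. 1 / (real k)\<^sup>2) \<le> (\<Sum>k=Suc s..<Suc s + (j - 1). 1 / (real k)\<^sup>2)"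
    by (intro sum_mono2) auto
  also have "\<dots> \<le> 1 / real s" using * by (smt (verit) divide_nonneg_nonneg of_nat_0_le_iff)
  finally show ?thesis .
qed

text \<open>With R = q^(-k) = (1 + 1/s)^k the factor is 1 + 1/(R - 1), and R is bounded below by its
  binomial expansion up to second order. The linear term gives the first bound, used for k \<le> s;
  the quadratic term gives the second, used for k > s, where its exponents are summable.\<close>

lemma inverse_one_minus_ratio_power_le:
  fixes s k :: nat
  assumes "0 < s" "0 < k"
  defines "q \<equiv> real s / (real s + 1)"
  shows "1 / (1 - q ^ k) \<le> 1 + real s / real k"
    and "1 / (1 - q ^ k) \<le> exp (2 * (real s)\<^sup>2 / (real k)\<^sup>2)"
proof -
  define R where "R = (1 + 1 / real s) ^ k"
  have q: "q ^ k = 1 / R"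
  proof -
    have "1 + 1 / real s = (real s + 1) / real s" using assms(1) by (simp add: field_simps)
    then have "q * (1 + 1 / real s) = 1" using assms(1) by (simp add: q_def)
    then have "q ^ k * R = 1" unfolding R_def by (metis power_mult_distrib power_one)
    moreover have "R \<noteq> 0" using calculation by auto
    ultimately show ?thesis by (simp add: field_simps)
  qed
  have bin: "R \<ge> 1 + real k / real s + real k * (real k - 1) / (2 * (real s)\<^sup>2)"
    unfolding R_def
  proof (induction k)
    case (Suc k)
    define x where "x = 1 / real s"
    have x: "x \<ge> 0" by (simp add: x_def)
    have "(1 + real k * x + real k * (real k - 1) * x\<^sup>2 / 2) * (1 + x) \<le> (1 + x) ^ k * (1 + x)"
      using Suc x by (intro mult_right_mono) (auto simp: x_def field_simps)
    moreover have "0 \<le> real k * (real k - 1)" by (cases k) auto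
    then have "0 \<le> real k * (real k - 1) * x ^ 3 / 2" using x by simp
    moreover have "(1 + real k * x + real k * (real k - 1) * x\<^sup>2 / 2) * (1 + x)
      = 1 + real (Suc k) * x + real (Suc k) * (real (Suc k) - 1) * x\<^sup>2 / 2 + real k * (real k - 1) * x ^ 3 / 2"
      by (simp add: field_simps power2_eq_square power3_eq_cube)
    ultimately have "1 + real (Suc k) * x + real (Suc k) * (real (Suc k) - 1) * x\<^sup>2 / 2 \<le> (1 + x) ^ Suc k"
      by (simp add: mult.commute)
    then show ?case by (simp add: x_def power_divide field_simps)
  qed simp
  have kk: "real k * (real k - 1) \<ge> 0" using assms by simp
  have R1: "R - 1 \<ge> real k / real s"
    using bin kk by (smt (verit) divide_nonneg_nonneg zero_le_power2 of_nat_0_le_iff)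
  have pos: "real k / real s > 0" using assms by simp
  have eq: "1 / (1 - q ^ k) = 1 + 1 / (R - 1)"
    using R1 pos unfolding q by (simp add: field_simps)
  have "1 / (R - 1) \<le> 1 / (real k / real s)" using R1 pos by (intro divide_left_mono mult_pos_pos) auto
  then show "1 / (1 - q ^ k) \<le> 1 + real s / real k" using eq by simp
  have "real k / (2 * (real s)\<^sup>2) \<le> real k / real s"
    using assms by (intro divide_left_mono) (auto simp: power2_eq_square)
  then have R2: "R - 1 \<ge> (real k)\<^sup>2 / (2 * (real s)\<^sup>2)"
    using bin by (simp add: power2_eq_square algebra_simps diff_divide_distrib)
  have "1 / (R - 1) \<le> 1 / ((real k)\<^sup>2 / (2 * (real s)\<^sup>2))"
  proof (rule divide_left_mono[OF R2])
    show "0 < (R - 1) * ((real k)\<^sup>2 / (2 * (real s)\<^sup>2))"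
    proof (rule mult_pos_pos)
      show "0 < R - 1" using R1 pos by linarith
    qed (use assms in simp)
  qed simp
  then have "1 / (1 - q ^ k) \<le> 1 + 2 * (real s)\<^sup>2 / (real k)\<^sup>2" using eq by simp
  also have "\<dots> \<le> exp (2 * (real s)\<^sup>2 / (real k)\<^sup>2)" by (rule exp_ge_add_one_self)
  finally show "1 / (1 - q ^ k) \<le> exp (2 * (real s)\<^sup>2 / (real k)\<^sup>2)" .
qed

text \<open>With s about sqrt t and q = s/(s+1), the factors up to s contribute at most 4^s \<le>
  exp (2s), the later ones exp (2s), and q^(-t) at most exp s. Rounding up gives s \<le> 2 sqrt t,
  hence 5s \<le> 10 sqrt t.\<close>

lemma card_youngs_le:
  "real (card {T. young T \<and> finite T \<and> card T = t}) \<le> exp (10 * sqrt (real t))"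
proof (cases "t = 0")
  case True
  have "{T. young T \<and> finite T \<and> card T = t} \<subseteq> {{}}" using True by auto
  then have "card {T. young T \<and> finite T \<and> card T = t} \<le> card {{} :: (nat \<times> nat) set}"
    by (intro card_mono) auto
  then show ?thesis using True by simp
next
  case False
  define s where "s = nat \<lceil>sqrt (real t)\<rceil>"
  have st: "sqrt (real t) \<ge> 1" using False by simp
  have s: "s > 0" "sqrt (real t) \<le> real s" "real s \<le> 2 * sqrt (real t)"
    using st unfolding s_def by linarith+
  define q where "q = real s / (real s + 1)"
  have q: "0 < q" "q < 1" using s(1) by (auto simp: q_def)
  define P where "P = (\<Prod>k=1..t. 1 - q ^ k)"
  have qk: "1 - q ^ k > 0" if "k > 0" for k using q that by (simp add: power_less_one_iff)
  have P: "P > 0" unfolding P_def using qk by (intro prod_pos) auto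
  have eq: "{T. young T \<and> finite T \<and> card T = t} = youngs_within t t"
    using young_subset_square unfolding youngs_within_def by blast
  have "real (card (youngs_within t t)) \<le> (1 / P) * (1 / q) ^ t"
    using card_youngs_within_le[OF q, of t t] P q
    by (simp add: P_def field_simps power_divide)
  also have "\<dots> \<le> (4 ^ s * exp (2 * real s)) * exp (real s)"
  proof (rule mult_mono)
    show "(1 / q) ^ t \<le> exp (real s)"
    proof -
      have "(1 / q) ^ t \<le> exp (1 / real s) ^ t"
        using s q exp_ge_add_one_self[of "1 / real s"] by (intro power_mono) (auto simp: q_def field_simps)
      also have "\<dots> = exp (real t / real s)" by (simp flip: exp_of_nat_mult)
      also have "real t \<le> real s * real s"
        using s(2) by (smt (verit) mult_mono real_sqrt_ge_zero of_nat_0_le_iff real_sqrt_mult_self)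
      then have "real t / real s \<le> real s" using s(1) by (simp add: field_simps)
      finally show ?thesis by simp
    qed
    show "1 / P \<le> 4 ^ s * exp (2 * real s)"
    proof -
      have "1 / P = (\<Prod>k=1..t. 1 / (1 - q ^ k))" unfolding P_def by (simp add: prod_dividef)
      \<comment> \<open>The s additional factors are all at least 1. They allow the product to be
        split at s without comparing s with t.\<close>
      also have "\<dots> \<le> (\<Prod>k=1..t+s. 1 / (1 - q ^ k))"
      proof -
        have "(\<Prod>k\<in>{1..t+s}. 1 / (1 - q ^ k)) = (\<Prod>k\<in>{1..t}. 1 / (1 - q ^ k)) * (\<Prod>k\<in>{t+1..t+s}. 1 / (1 - q ^ k))"
          by (rule prod.ub_add_nat) simp
        moreover have "1 \<le> (\<Prod>k\<in>{t+1..t+s}. 1 / (1 - q ^ k))"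
          using qk q by (intro prod_ge_1) (auto simp: field_simps)
        moreover have "0 \<le> (\<Prod>k\<in>{1..t}. 1 / (1 - q ^ k))"
          using qk by (intro prod_nonneg) (auto simp: less_imp_le)
        ultimately show ?thesis using mult_left_mono by fastforce
      qed
      also have "\<dots> = (\<Prod>k=1..s. 1 / (1 - q ^ k)) * (\<Prod>k=s+1..s+t. 1 / (1 - q ^ k))"
        using prod.ub_add_nat[of 1 s _ t] by (simp add: add.commute)
      also have "\<dots> \<le> 4 ^ s * exp (2 * real s)"
      proof (rule mult_mono)
        have "(\<Prod>k=1..s. 1 / (1 - q ^ k)) \<le> (\<Prod>k=1..s. 1 + real s / real k)"
          using qk s(1) inverse_one_minus_ratio_power_le(1)[of s] unfolding q_def
          by (intro prod_mono) (auto simp: less_imp_le)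
        also have "\<dots> \<le> 4 ^ s" by (rule prod_one_plus_le_four_pow)
        finally show "(\<Prod>k=1..s. 1 / (1 - q ^ k)) \<le> 4 ^ s" .
        have "(\<Prod>k=s+1..s+t. 1 / (1 - q ^ k)) \<le> (\<Prod>k=s+1..s+t. exp (2 * (real s)\<^sup>2 / (real k)\<^sup>2))"
          using qk s(1) inverse_one_minus_ratio_power_le(2)[of s] unfolding q_def
          by (intro prod_mono) (auto simp: less_imp_le)
        also have "\<dots> = exp (\<Sum>k=s+1..s+t. 2 * (real s)\<^sup>2 / (real k)\<^sup>2)" by (simp add: exp_sum)
        also have "(\<Sum>k=s+1..s+t. 2 * (real s)\<^sup>2 / (real k)\<^sup>2)
            = 2 * (real s)\<^sup>2 * (\<Sum>k=Suc s..<s + Suc t. 1 / (real k)\<^sup>2)"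
          unfolding sum_distrib_left by (rule sum.cong) auto
        also have "\<dots> \<le> 2 * (real s)\<^sup>2 * (1 / real s)"
          by (intro mult_left_mono sum_inverse_squares_le s) auto
        finally show "(\<Prod>k=s+1..s+t. 1 / (1 - q ^ k)) \<le> exp (2 * real s)"
          using s(1) by (simp add: power2_eq_square)
        show "0 \<le> (\<Prod>k=s+1..s+t. 1 / (1 - q ^ k))"
          using qk by (intro prod_nonneg) (auto simp: less_imp_le)
      qed simp
      finally show ?thesis .
    qed
  qed (use q in auto)
  also have "4 ^ s * exp (2 * real s) * exp (real s) \<le> exp (2 * real s) * exp (2 * real s) * exp (real s)"
  proof -
    have "(4::real) \<le> exp 2" using exp_lower_Taylor_quadratic[of "2::real"] by simp
    then have "(4::real) ^ s \<le> exp 2 ^ s" by (intro power_mono) auto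
    then show ?thesis by (simp add: mult.commute flip: exp_of_nat_mult)
  qed
  also have "\<dots> = exp (5 * real s)" by (simp flip: exp_add)
  also have "\<dots> \<le> exp (10 * sqrt (real t))" using s(3) by simp
  finally show ?thesis unfolding eq .
qed

section \<open>Encoding by slices\<close>

text \<open>List the elements of a subset and pad with the blank \<open>None\<close> to length Z:
  every subset arises from a word of length Z over card F + 1 letters.\<close>

lemma card_small_subsets_le:
  assumes "finite F"
  shows "card {A. A \<subseteq> F \<and> card A \<le> Z} \<le> (card F + 1) ^ Z"
proof -
  let ?L = "{l. set l \<subseteq> insert None (Some ` F) \<and> length l = Z}"
  have fin: "finite ?L" by (rule finite_lists_length_eq) (use assms in simp)
  have "{A. A \<subseteq> F \<and> card A \<le> Z} \<subseteq> (\<lambda>l. {x. Some x \<in> set l}) ` ?L"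
  proof
    fix A assume "A \<in> {A. A \<subseteq> F \<and> card A \<le> Z}"
    then have A: "A \<subseteq> F" "card A \<le> Z" by auto
    obtain xs where xs: "set xs = A" "distinct xs"
      using finite_distinct_list[OF finite_subset[OF A(1) assms]] by blast
    then have len: "length xs \<le> Z" using A(2) distinct_card[OF xs(2)] by simp
    define l where "l = map Some xs @ replicate (Z - length xs) None"
    have "l \<in> ?L" using xs(1) A(1) len unfolding l_def by (auto simp: set_replicate_conv_if)
    moreover have "A = {x. Some x \<in> set l}" using xs(1) unfolding l_def by (auto simp: set_replicate_conv_if)
    ultimately show "A \<in> (\<lambda>l. {x. Some x \<in> set l}) ` ?L" by (rule rev_image_eqI)
  qed
  then have "card {A. A \<subseteq> F \<and> card A \<le> Z} \<le> card ?L"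
    by (rule surj_card_le[OF fin])
  also have "\<dots> = card (insert None (Some ` F)) ^ Z"
    by (rule card_lists_length_eq) (use assms in simp)
  also have "card (insert None (Some ` F)) = card F + 1"
    using assms by (subst card_insert_disjoint) (auto simp: card_image)
  finally show ?thesis .
qed

definition youngs_upto :: "nat \<Rightarrow> (nat \<times> nat) set set" where
  "youngs_upto n = {T. young T \<and> finite T \<and> card T \<le> n}"

lemma youngs_upto_eq_UN: "youngs_upto n = (\<Union>t\<in>{..n}. {T. young T \<and> finite T \<and> card T = t})"
  by (auto simp: youngs_upto_def)

lemma finite_youngs_upto: "finite (youngs_upto n)"
  unfolding youngs_upto_eq_UN by (intro finite_UN_I finite_atMost finite_youngs_card)

text \<open>The weight cancels the bound on the number of diagrams of each size, so every size
  contributes at most 1.\<close>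

lemma sum_exp_youngs_upto_le:
  "(\<Sum>T\<in>youngs_upto n. exp (- 10 * sqrt (real (card T)))) \<le> real (n + 1)"
proof -
  let ?Y = "\<lambda>t. {T. young T \<and> finite T \<and> card T = t}"
  have "(\<Sum>T\<in>youngs_upto n. exp (- 10 * sqrt (real (card T))))
      = (\<Sum>t\<in>{..n}. \<Sum>T\<in>?Y t. exp (- 10 * sqrt (real (card T))))"
    unfolding youngs_upto_eq_UN by (rule sum.UNION_disjoint) (use finite_youngs_card in auto)
  also have "\<dots> = (\<Sum>t\<in>{..n}. real (card (?Y t)) * exp (- 10 * sqrt (real t)))"
    by simp
  also have "\<dots> \<le> (\<Sum>t\<in>{..n}. exp (10 * sqrt (real t)) * exp (- 10 * sqrt (real t)))"
    by (intro sum_mono mult_right_mono card_youngs_le) auto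
  also have "\<dots> = real (n + 1)" by (simp flip: exp_add)
  finally show ?thesis .
qed

text \<open>Exponential weighting avoids listing the possible size vectors: a family within the
  budget C has exp (10 C) times its weight at least 1, and the total weight of all families is a
  product over the slices.\<close>

lemma card_young_families_le:
  assumes "finite A"
  shows "real (card {h \<in> A \<rightarrow>\<^sub>E youngs_upto n. (\<Sum>f\<in>A. sqrt (real (card (h f)))) \<le> C})
     \<le> real (n + 1) ^ card A * exp (10 * C)"
proof -
  let ?H = "{h \<in> A \<rightarrow>\<^sub>E youngs_upto n. (\<Sum>f\<in>A. sqrt (real (card (h f)))) \<le> C}"
  let ?w = "\<lambda>h. \<Prod>f\<in>A. exp (- 10 * sqrt (real (card (h f))))"
  have fin: "finite (A \<rightarrow>\<^sub>E youngs_upto n)"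
    by (intro finite_PiE assms finite_youngs_upto)
  have "real (card ?H) = (\<Sum>h\<in>?H. 1)" by simp
  also have "\<dots> \<le> (\<Sum>h\<in>?H. exp (10 * C) * ?w h)"
  proof (rule sum_mono)
    fix h assume h: "h \<in> ?H"
    have "?w h = exp (- 10 * (\<Sum>f\<in>A. sqrt (real (card (h f)))))"
      unfolding sum_distrib_left using assms by (rule exp_sum[symmetric])
    also have "\<dots> \<ge> exp (- 10 * C)" using h by simp
    finally have "exp (10 * C) * exp (- 10 * C) \<le> exp (10 * C) * ?w h" by (intro mult_left_mono) auto
    moreover have "exp (10 * C) * exp (- 10 * C) = 1" by (simp flip: exp_add)
    ultimately show "1 \<le> exp (10 * C) * ?w h" by linarith
  qed
  also have "\<dots> \<le> (\<Sum>h\<in>A \<rightarrow>\<^sub>E youngs_upto n. exp (10 * C) * ?w h)"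
    by (intro sum_mono2 fin) (auto intro!: mult_nonneg_nonneg prod_nonneg)
  also have "\<dots> = exp (10 * C) * (\<Prod>f\<in>A. \<Sum>T\<in>youngs_upto n. exp (- 10 * sqrt (real (card T))))"
    unfolding sum_distrib_left[symmetric] using assms finite_youngs_upto
    by (subst prod_sum_PiE) simp_all
  also have "\<dots> \<le> exp (10 * C) * (\<Prod>f\<in>A. real (n + 1))"
  proof (rule mult_left_mono, rule prod_mono, rule conjI)
    show "0 \<le> (\<Sum>T\<in>youngs_upto n. exp (- 10 * sqrt (real (card T))))" by (rule sum_nonneg) simp
  qed (rule sum_exp_youngs_upto_le, simp)
  finally show ?thesis by (simp only: prod_constant mult.commute)
qed

text \<open>A set is recovered from the names of its slices and their diagrams as a union, so the
  slices may overlap. Each slice costs a factor card F + 1 for its name and n + 1 for the weighted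
  sum over its diagram; only the square roots of the sizes enter the exponential.\<close>

lemma card_le_of_slice_covers:
  fixes T :: "'f \<Rightarrow> 'a set \<Rightarrow> (nat \<times> nat) set"
  assumes F: "finite F"
    and cov: "\<And>S. S \<in> \<S> \<Longrightarrow> \<exists>A\<subseteq>F. card A \<le> Z \<and> (\<forall>f\<in>A. T f S \<in> youngs_upto n)
        \<and> (\<Sum>f\<in>A. sqrt (real (card (T f S)))) \<le> C \<and> S = (\<Union>f\<in>A. g f ` T f S)"
  shows "real (card \<S>) \<le> (real (card F + 1) * real (n + 1)) ^ Z * exp (10 * C)"
proof -
  define good where "good = (\<lambda>S A. A \<subseteq> F \<and> card A \<le> Z \<and> (\<forall>f\<in>A. T f S \<in> youngs_upto n)
        \<and> (\<Sum>f\<in>A. sqrt (real (card (T f S)))) \<le> C \<and> S = (\<Union>f\<in>A. g f ` T f S))"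
  have "\<forall>S\<in>\<S>. \<exists>A. good S A" unfolding good_def by (intro ballI cov)
  then obtain A where "\<forall>S\<in>\<S>. good S (A S)" by (rule bchoice[THEN exE])
  then have A: "A S \<subseteq> F" "card (A S) \<le> Z" "\<And>f. f \<in> A S \<Longrightarrow> T f S \<in> youngs_upto n"
      "(\<Sum>f\<in>A S. sqrt (real (card (T f S)))) \<le> C" "S = (\<Union>f\<in>A S. g f ` T f S)"
    if "S \<in> \<S>" for S
    using that by (simp_all add: good_def)
  define D where "D = {A. A \<subseteq> F \<and> card A \<le> Z}"
  define H where "H = (\<lambda>A :: 'f set. {h \<in> A \<rightarrow>\<^sub>E youngs_upto n. (\<Sum>f\<in>A. sqrt (real (card (h f)))) \<le> C})"
  define code where "code = (\<lambda>S. (A S, restrict (\<lambda>f. T f S) (A S)))"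
  have finD: "finite D" unfolding D_def using F by simp
  have finH: "finite (H B)" if "B \<in> D" for B
  proof -
    have "finite B" using that F finite_subset by (auto simp: D_def)
    then show ?thesis unfolding H_def
      by (intro finite_Collect_conjI disjI1) (simp add: finite_PiE finite_youngs_upto)
  qed
  have inj: "inj_on code \<S>"
  proof (rule inj_onI)
    fix S S' assume S: "S \<in> \<S>" "S' \<in> \<S>" and eq: "code S = code S'"
    have AS: "A S' = A S" using eq by (simp add: code_def)
    have "T f S = T f S'" if "f \<in> A S" for f
      using fun_cong[of _ _ f, OF arg_cong[OF eq, of snd]] that AS by (simp add: code_def)
    then have "(\<Union>f\<in>A S. g f ` T f S) = (\<Union>f\<in>A S. g f ` T f S')" by simp
    also have "\<dots> = S'" using A(5)[OF S(2)] AS by simp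
    finally show "S = S'" using A(5)[OF S(1)] by simp
  qed
  have "code ` \<S> \<subseteq> Sigma D H"
  proof
    fix x assume "x \<in> code ` \<S>"
    then obtain S where S: "S \<in> \<S>" "x = code S" by blast
    show "x \<in> Sigma D H"
      unfolding S(2) code_def D_def H_def using A(1-4)[OF S(1)] by simp
  qed
  then have "card \<S> \<le> card (Sigma D H)"
    using card_inj_on_le[OF inj] finD finH by blast
  also have "\<dots> = (\<Sum>B\<in>D. card (H B))" using finD finH by (simp add: card_SigmaI)
  finally have "real (card \<S>) \<le> (\<Sum>B\<in>D. real (card (H B)))"
    by (metis of_nat_le_iff of_nat_sum)
  also have "\<dots> \<le> (\<Sum>B\<in>D. real (n + 1) ^ Z * exp (10 * C))"
  proof (rule sum_mono)
    fix B assume B: "B \<in> D"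
    then have "finite B" using F finite_subset by (auto simp: D_def)
    then have "real (card (H B)) \<le> real (n + 1) ^ card B * exp (10 * C)"
      unfolding H_def by (rule card_young_families_le)
    also have "\<dots> \<le> real (n + 1) ^ Z * exp (10 * C)"
      using B by (intro mult_right_mono power_increasing) (auto simp: D_def)
    finally show "real (card (H B)) \<le> real (n + 1) ^ Z * exp (10 * C)" .
  qed
  also have "\<dots> = real (card D) * (real (n + 1) ^ Z * exp (10 * C))" by simp
  also have "\<dots> \<le> real (card F + 1) ^ Z * (real (n + 1) ^ Z * exp (10 * C))"
  proof (rule mult_right_mono)
    show "real (card D) \<le> real (card F + 1) ^ Z"
      using card_small_subsets_le[OF F, of Z] unfolding D_def by (metis of_nat_le_iff of_nat_power)
  qed auto
  finally show ?thesis by (simp add: power_mult_distrib mult_ac)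
qed

text \<open>The index $(\alpha,i,j,z)$ stands for the slice through $z$ in directions $i$ and $j$, restricted
  to $x_i, x_j \geq \alpha$; its diagram in $S$ is the preimage of $S$ under \<open>glue\<close>.\<close>
fun glue :: "nat \<times> nat \<times> nat \<times> (nat \<Rightarrow> nat) \<Rightarrow> nat \<times> nat \<Rightarrow> nat \<Rightarrow> nat" where
  "glue (\<alpha>, i, j, z) (a, b) = z(i := \<alpha> + a, j := \<alpha> + b)"

lemma inj_glue: "i \<noteq> j \<Longrightarrow> inj (glue (\<alpha>, i, j, z))"
proof (rule injI)
  fix u v assume ij: "i \<noteq> j" and eq: "glue (\<alpha>, i, j, z) u = glue (\<alpha>, i, j, z) v"
  obtain a b a' b' where uv: "u = (a, b)" "v = (a', b')" by (metis surj_pair)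
  from fun_cong[OF eq, of i] fun_cong[OF eq, of j] ij show "u = v" by (simp add: uv)
qed

lemma lower_setD:
  assumes "is_lower_set d S" "x \<in> S" "\<And>i. i < d \<Longrightarrow> x' i \<le> x i" "\<And>i. i \<ge> d \<Longrightarrow> x' i = 0"
  shows "x' \<in> S"
  using assms unfolding is_lower_set_def lattice_pts_def by blast

lemma lower_set_zero: "is_lower_set d S \<Longrightarrow> x \<in> S \<Longrightarrow> i \<ge> d \<Longrightarrow> x i = 0"
  unfolding is_lower_set_def lattice_pts_def by auto

lemma lower_set_upd:
  assumes "is_lower_set d S" "x \<in> S" "c \<le> x i"
  shows "x(i := c) \<in> S"
  by (rule lower_setD[OF assms(1,2)])
    (use assms(3) lower_set_zero[OF assms(1,2)] in \<open>auto split: if_splits\<close>)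

lemma lower_set_upd2:
  assumes "is_lower_set d S" "x \<in> S" "c \<le> x i" "c' \<le> x j"
  shows "x(i := c, j := c') \<in> S"
  by (rule lower_setD[OF assms(1,2)])
    (use assms(3,4) lower_set_zero[OF assms(1,2)] in \<open>auto split: if_splits\<close>)

lemma lower_set_coord_less:
  assumes "is_lower_set d S" "finite S" "x \<in> S"
  shows "x i < card S"
proof -
  have "inj_on (\<lambda>c. x(i := c)) {..x i}" by (rule inj_onI) (metis fun_upd_same)
  moreover have "(\<lambda>c. x(i := c)) ` {..x i} \<subseteq> S"
    using lower_set_upd[OF assms(1,3)] by auto
  ultimately have "card {..x i} \<le> card S" using assms(2) by (rule card_inj_on_le)
  then show ?thesis by simp
qed

lemma young_glue_vimage:
  assumes "is_lower_set d S" "finite S" "i \<noteq> j"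
  shows "glue (\<alpha>, i, j, z) -` S \<in> youngs_upto (card S)"
proof -
  have "young (glue (\<alpha>, i, j, z) -` S)"
    unfolding young_def
  proof (intro allI impI)
    fix a b a' b' assume "(a, b) \<in> glue (\<alpha>, i, j, z) -` S" and le: "a' \<le> a" "b' \<le> b"
    then have x: "z(i := \<alpha> + a, j := \<alpha> + b) \<in> S" by simp
    show "(a', b') \<in> glue (\<alpha>, i, j, z) -` S"
      using lower_set_upd2[OF assms(1) x, of "\<alpha> + a'" i "\<alpha> + b'" j] le assms(3)
      by (simp add: fun_upd_twist[of i j])
  qed
  moreover have "finite (glue (\<alpha>, i, j, z) -` S)"
    by (rule finite_vimageI[OF assms(2) inj_glue[OF assms(3)]])
  moreover have "card (glue (\<alpha>, i, j, z) -` S) \<le> card S"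
    by (rule card_inj_on_le[OF inj_on_subset[OF inj_glue[OF assms(3)] subset_UNIV] _ assms(2)]) auto
  ultimately show ?thesis by (simp add: youngs_upto_def)
qed

section \<open>Classes of points with the same large coordinates\<close>

definition big :: "nat \<Rightarrow> nat \<Rightarrow> (nat \<Rightarrow> nat) \<Rightarrow> nat set" where
  "big d M x = {i. i < d \<and> M \<le> x i}"

lemma big_subset: "big d M x \<subseteq> {..<d}" and finite_big [simp]: "finite (big d M x)"
  by (auto simp: big_def)

definition big_class :: "nat \<Rightarrow> nat \<Rightarrow> (nat \<Rightarrow> nat) set \<Rightarrow> nat set \<Rightarrow> (nat \<Rightarrow> nat) set" where
  "big_class d M S K = {x \<in> S. big d M x = K}"

text \<open>One label for each slice in directions i and j that meets the class. Slices with
  different labels are disjoint, which makes the counts below additive.\<close>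

definition class_base :: "nat \<Rightarrow> nat \<Rightarrow> (nat \<Rightarrow> nat) set \<Rightarrow> nat set \<Rightarrow> nat \<Rightarrow> nat \<Rightarrow> (nat \<Rightarrow> nat) set" where
  "class_base d M S K i j = (\<lambda>x. x(i := 0, j := 0)) ` big_class d M S K"

context
  fixes d n :: nat and S :: "(nat \<Rightarrow> nat) set"
  assumes lower: "is_lower_set d S" and fin: "finite S" and card_S: "card S = n"
begin

text \<open>Below each point with coordinate M lie M points of S on the line in direction i, and
  different points have different lines. The points with \<open>x i = M\<close> stand for the
  projection of the part of S with x_i \<ge> M.\<close>

lemma mult_card_coord_eq_le: "M * card {x \<in> S. x i = M} \<le> n"
proof -
  let ?f = "\<lambda>(x :: nat \<Rightarrow> nat, c :: nat). x(i := c)"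
  have "inj_on ?f ({x \<in> S. x i = M} \<times> {..<M})"
  proof (rule inj_onI, clarify, goal_cases)
    case (1 x a y b)
    then have xy: "x i = M" "y i = M" and eq: "x(i := a) = y(i := b)" by auto
    have "a = b" using fun_cong[OF eq, of i] by simp
    moreover have "x l = y l" for l using fun_cong[OF eq, of l] xy by (cases "l = i") auto
    ultimately show "x = y \<and> a = b" by auto
  qed
  moreover have "?f ` ({x \<in> S. x i = M} \<times> {..<M}) \<subseteq> S"
    using lower_set_upd[OF lower] by auto
  ultimately have "card ({x \<in> S. x i = M} \<times> {..<M}) \<le> card S"
    using fin by (rule card_inj_on_le)
  then show ?thesis by (simp add: card_cartesian_product card_S mult.commute)
qed

lemma finite_big_class [simp]: "finite (big_class d M S K)" unfolding big_class_def using fin by simp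

lemma finite_class_base [simp]: "finite (class_base d M S K i j)" unfolding class_base_def by simp

text \<open>Moving the coordinates i and j among values \<ge> M does not change which coordinates
  are large. So the part of the slice that \<open>glue\<close> sees stays in the class, while its
  values below M fill a whole M by M square of S.\<close>

lemma class_baseD:
  assumes "z \<in> class_base d M S K i j" "i \<in> K" "j \<in> K" "i \<noteq> j"
  shows "z i = 0" "z j = 0" "z(i := M + a, j := M + b) \<in> S \<Longrightarrow> z(i := M + a, j := M + b) \<in> big_class d M S K"
    "c < M \<Longrightarrow> c' < M \<Longrightarrow> z(i := c, j := c') \<in> S"
proof -
  obtain x where x: "x \<in> big_class d M S K" "z = x(i := 0, j := 0)" using assms(1) by (auto simp: class_base_def)
  show "z i = 0" "z j = 0" using x by auto
  have K: "big d M x = K" "x \<in> S" using x by (auto simp: big_class_def)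
  then have ij: "i < d" "j < d" "M \<le> x i" "M \<le> x j" using assms(2,3) by (auto simp: big_def)
  have "big d M (z(i := M + a, j := M + b)) = big d M x"
    using ij unfolding big_def x(2) by auto
  then show "z(i := M + a, j := M + b) \<in> S \<Longrightarrow> z(i := M + a, j := M + b) \<in> big_class d M S K"
    using K by (simp add: big_class_def)
  show "c < M \<Longrightarrow> c' < M \<Longrightarrow> z(i := c, j := c') \<in> S"
    using lower_set_upd2[OF lower K(2), of c i c' j] ij assms(4)
    unfolding x(2) by (simp add: fun_upd_twist[of i j])
qed

text \<open>Each fibre is the edge a = 0 of the diagram of its slice. These edges lie on the
  hyperplane x_i = M inside the class and are disjoint for different labels.\<close>

lemma sum_card_fibre_le:
  assumes "i \<in> K" "j \<in> K" "i \<noteq> j"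
  shows "(\<Sum>z\<in>class_base d M S K i j. card {b. z(i := M, j := M + b) \<in> S}) \<le> card {x \<in> big_class d M S K. x i = M}"
proof -
  let ?B = "\<lambda>z. {b. z(i := M, j := M + b) \<in> S}"
  let ?f = "\<lambda>(z :: nat \<Rightarrow> nat, b). z(i := M, j := M + b)"
  have finB: "finite (?B z)" for z
  proof -
    have "inj (\<lambda>b. z(i := M, j := M + b))" by (rule injI) (metis add_left_cancel fun_upd_same)
    then show ?thesis using finite_vimageI[OF fin] by (simp add: vimage_def)
  qed
  have inj: "inj_on ?f (Sigma (class_base d M S K i j) ?B)"
  proof (rule inj_onI, clarify)
    fix z z' b b'
    assume z: "z \<in> class_base d M S K i j" "z' \<in> class_base d M S K i j" and eq: "z(i := M, j := M + b) = z'(i := M, j := M + b')"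
    have "b = b'" using fun_cong[OF eq, of j] by simp
    moreover have "z l = z' l" for l
      using fun_cong[OF eq, of l] class_baseD(1,2)[OF z(1) assms] class_baseD(1,2)[OF z(2) assms] assms(3)
      by (cases "l = i"; cases "l = j") auto
    ultimately show "z = z' \<and> b = b'" by auto
  qed
  have sub: "?f ` Sigma (class_base d M S K i j) ?B \<subseteq> {x \<in> big_class d M S K. x i = M}"
    using class_baseD(3)[OF _ assms, of _ M 0] assms(3) by auto
  have "(\<Sum>z\<in>class_base d M S K i j. card (?B z)) = card (Sigma (class_base d M S K i j) ?B)"
    using finB by (simp add: card_SigmaI)
  also have "\<dots> \<le> card {x \<in> big_class d M S K. x i = M}"
    by (rule card_inj_on_le[OF inj sub]) simp
  finally show ?thesis .
qed

lemma sum_sqrt_class_le: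
  assumes "i \<in> K" "j \<in> K" "i \<noteq> j"
  shows "(\<Sum>z\<in>class_base d M S K i j. sqrt (real (card (glue (M, i, j, z) -` S))))
      \<le> (real (card {x \<in> big_class d M S K. x i = M}) + real (card {x \<in> big_class d M S K. x j = M})) / 2"
proof -
  let ?c = "\<lambda>z. {b. z(i := M, j := M + b) \<in> S}" and ?r = "\<lambda>z. {a. z(j := M, i := M + a) \<in> S}"
  \<comment> \<open>The labels are symmetric in i and j, so the fibre bound also applies with the
    two directions exchanged and controls the other edge of each diagram.\<close>
  have tw: "class_base d M S K j i = class_base d M S K i j" unfolding class_base_def using assms(3) by (simp add: fun_upd_twist)
  have "sqrt (real (card (glue (M, i, j, z) -` S))) \<le> (real (card (?c z)) + real (card (?r z))) / 2" for z
  proof -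
    let ?T = "glue (M, i, j, z) -` S"
    have T: "young ?T" "finite ?T"
      using young_glue_vimage[OF lower fin assms(3)] by (auto simp: youngs_upto_def)
    have c: "?c z = {b. (0, b) \<in> ?T}" and r: "?r z = {a. (a, 0) \<in> ?T}"
      using assms(3) by (simp_all add: fun_upd_twist[of j i])
    have "finite (Pair 0 -` ?T)" "finite ((\<lambda>a. (a, 0)) -` ?T)"
      by (rule finite_vimageI[OF T(2)], simp add: inj_on_def)+
    then have fins: "finite (?c z)" "finite (?r z)"
      unfolding c r by (simp_all only: vimage_def)
    have "?T \<subseteq> {a. (a, 0) \<in> ?T} \<times> {b. (0, b) \<in> ?T}"
    proof (rule subsetI)
      fix u assume u: "u \<in> ?T"
      obtain a b where ab: "u = (a, b)" by (cases u)
      show "u \<in> {a. (a, 0) \<in> ?T} \<times> {b. (0, b) \<in> ?T}"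
        using youngD[OF T(1) u[unfolded ab], of a 0] youngD[OF T(1) u[unfolded ab], of 0 b]
        unfolding ab by simp
    qed
    then have "?T \<subseteq> ?r z \<times> ?c z" unfolding c r .
    then have "card ?T \<le> card (?r z \<times> ?c z)" by (rule card_mono[rotated]) (use fins in simp)
    then have "real (card ?T) \<le> real (card (?c z)) * real (card (?r z))"
      by (simp add: card_cartesian_product mult.commute flip: of_nat_mult)
    then have "sqrt (real (card ?T)) \<le> sqrt (real (card (?c z)) * real (card (?r z)))" by simp
    also have "\<dots> \<le> (real (card (?c z)) + real (card (?r z))) / 2" by (rule arith_geo_mean_sqrt) auto
    finally show ?thesis .
  qed
  then have "(\<Sum>z\<in>class_base d M S K i j. sqrt (real (card (glue (M, i, j, z) -` S))))
      \<le> (\<Sum>z\<in>class_base d M S K i j. (real (card (?c z)) + real (card (?r z))) / 2)"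
    by (rule sum_mono)
  also have "\<dots> = (real (\<Sum>z\<in>class_base d M S K i j. card (?c z)) + real (\<Sum>z\<in>class_base d M S K j i. card (?r z))) / 2"
    by (simp add: tw sum.distrib flip: sum_divide_distrib)
  also have "\<dots> \<le> (real (card {x \<in> big_class d M S K. x i = M}) + real (card {x \<in> big_class d M S K. x j = M})) / 2"
    using sum_card_fibre_le[OF assms, of M] sum_card_fibre_le[OF assms(2,1) not_sym[OF assms(3)], of M]
    by (intro divide_right_mono add_mono of_nat_mono) simp_all
  finally show ?thesis .
qed

text \<open>Every slice through the class contains a full M by M square of points of S, and squares
  with different labels are disjoint.\<close>

lemma card_class_base_mult_le:
  assumes "i \<in> K" "j \<in> K" "i \<noteq> j"
  shows "card (class_base d M S K i j) * M\<^sup>2 \<le> n"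
proof -
  let ?f = "\<lambda>(z :: nat \<Rightarrow> nat, a, b). z(i := a, j := b)"
  let ?D = "class_base d M S K i j \<times> {..<M} \<times> {..<M}"
  have "inj_on ?f ?D"
  proof (rule inj_onI, clarify, goal_cases)
    case (1 z a b z' a' b')
    then have z: "z \<in> class_base d M S K i j" "z' \<in> class_base d M S K i j" and eq: "z(i := a, j := b) = z'(i := a', j := b')"
      by auto
    have "b = b'" "a = a'" using fun_cong[OF eq, of j] fun_cong[OF eq, of i] assms(3) by auto
    moreover have "z l = z' l" for l
      using fun_cong[OF eq, of l] class_baseD(1,2)[OF z(1) assms] class_baseD(1,2)[OF z(2) assms] assms(3)
      by (cases "l = i"; cases "l = j") auto
    ultimately show ?case by auto
  qed
  moreover have "?f ` ?D \<subseteq> S" using class_baseD(4)[OF _ assms] by auto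
  ultimately have "card ?D \<le> card S" using fin by (rule card_inj_on_le)
  then show ?thesis by (simp add: card_cartesian_product card_S power2_eq_square mult.assoc)
qed

end

text \<open>The smallest value is at most s/k, and the second smallest at most s/(k - 1) \<le> 2s/k,
  where s is the sum and k the number of terms; together 3s/k.\<close>

lemma exists_small_pair:
  fixes a :: "'a \<Rightarrow> real"
  assumes "finite K" "card K \<ge> 2" "\<And>i. i \<in> K \<Longrightarrow> a i \<ge> 0"
  shows "\<exists>i\<in>K. \<exists>j\<in>K. i \<noteq> j \<and> a i + a j \<le> 3 / real (card K) * (\<Sum>i\<in>K. a i)"
proof -
  define s where "s = (\<Sum>i\<in>K. a i)"
  have s: "s \<ge> 0" unfolding s_def using assms(3) by (rule sum_nonneg)
  have "K \<noteq> {}" using assms(2) by auto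
  then obtain i where i: "i \<in> K" "\<And>k. k \<in> K \<Longrightarrow> a i \<le> a k"
    using ex_is_arg_min_if_finite[OF assms(1), of a] by (auto simp: is_arg_min_linorder)
  have cK: "card (K - {i}) = card K - 1" using i assms(1) by simp
  then have "K - {i} \<noteq> {}" using assms(2) by fastforce
  then obtain j where j: "j \<in> K - {i}" "\<And>k. k \<in> K - {i} \<Longrightarrow> a j \<le> a k"
    using ex_is_arg_min_if_finite[of "K - {i}" a] assms(1) by (auto simp: is_arg_min_linorder)
  have "real (card K) * a i \<le> s"
    unfolding s_def using sum_bounded_below[of K "a i" a] i by simp
  moreover have "real (card (K - {i})) * a j \<le> (\<Sum>k\<in>K - {i}. a k)"
    using sum_bounded_below[of "K - {i}" "a j" a] j by simp
  then have "(real (card K) - 1) * a j \<le> s"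
    using sum_mono2[of K "K - {i}" a] assms unfolding s_def cK by (simp add: of_nat_diff)
  moreover have "a j \<ge> 0" using j assms(3) by auto
  moreover define k where "k = real (card K)"
  moreover have k: "k \<ge> 2" unfolding k_def using assms(2) by simp
  ultimately have "k * a i \<le> s" "(k - 1) * a j \<le> s" "0 \<le> a j" by auto
  then have ai: "a i \<le> s / k" and "a j \<le> s / (k - 1)" using k by (auto simp: field_simps)
  note this(2)
  also have "s / (k - 1) \<le> s / (k / 2)" using k s by (intro divide_left_mono) auto
  also have "s / (k / 2) = 2 * (s / k)" by simp
  finally have "a i + a j \<le> 3 * (s / k)" using ai by linarith
  also have "\<dots> = 3 / k * s" by simp
  finally have "a i + a j \<le> 3 / k * s" .
  moreover have "j \<in> K" "i \<noteq> j" using j(1) by auto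
  ultimately show ?thesis using i(1) unfolding k_def s_def by (intro bexI[of _ i] bexI[of _ j] conjI)
qed

lemma sum_UN_le:
  fixes f :: "'b \<Rightarrow> real"
  assumes "finite I" "\<And>i. i \<in> I \<Longrightarrow> finite (B i)" "\<And>x. f x \<ge> 0"
  shows "(\<Sum>x\<in>(\<Union>i\<in>I. B i). f x) \<le> (\<Sum>i\<in>I. \<Sum>x\<in>B i. f x)"
  using assms(1,2)
proof (induction I rule: finite_induct)
  case (insert i I)
  have fin: "finite (B i)" "finite (\<Union>i\<in>I. B i)" using insert by auto
  have "(\<Sum>x\<in>(\<Union>i\<in>insert i I. B i). f x) = (\<Sum>x\<in>B i \<union> (\<Union>i\<in>I. B i). f x)" by simp
  also have "\<dots> \<le> (\<Sum>x\<in>B i. f x) + (\<Sum>x\<in>(\<Union>i\<in>I. B i). f x)"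
  proof -
    have "0 \<le> (\<Sum>x\<in>B i \<inter> (\<Union>i\<in>I. B i). f x)" by (rule sum_nonneg) (rule assms(3))
    then show ?thesis using sum.union_inter[OF fin, of f] by linarith
  qed
  finally show ?case using insert by simp
qed simp

section \<open>Points with many large coordinates\<close>

text \<open>A common pool of names for all sets of size n. Only the logarithm of its size matters
  later, so crude bounds on the entries suffice.\<close>

definition slice_index :: "nat \<Rightarrow> nat \<Rightarrow> (nat \<times> nat \<times> nat \<times> (nat \<Rightarrow> nat)) set" where
  "slice_index d n = {(\<alpha>, i, j, z). \<alpha> < n \<and> i < d \<and> j < d \<and> i \<noteq> j \<and> z \<in> lattice_pts d \<and> (\<forall>l. z l < n)}"

text \<open>R is the allowed value of the loss d/|K|; two elements are required so that there is a
  pair of directions to slice along.\<close>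

definition rich :: "nat \<Rightarrow> real \<Rightarrow> nat set set" where
  "rich d R = {K. K \<subseteq> {..<d} \<and> card K \<ge> 2 \<and> real d \<le> R * real (card K)}"

lemma finite_rich [simp]: "finite (rich d R)"
  by (rule finite_subset[of _ "Pow {..<d}"]) (auto simp: rich_def)

lemma card_rich_le: "card (rich d R) \<le> 2 ^ d"
proof -
  have "card (rich d R) \<le> card (Pow {..<d})" by (rule card_mono) (auto simp: rich_def)
  then show ?thesis by (simp add: card_Pow)
qed

context
  fixes d n :: nat and S :: "(nat \<Rightarrow> nat) set"
  assumes lower: "is_lower_set d S" and fin: "finite S" and card_S: "card S = n"
begin

text \<open>After exchanging the sums, fix the direction i. The classes are disjoint, so together
  they contain at most n/M points with x_i = M.\<close>

lemma sum_class_boundary_le: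
  assumes "M > 0"
  shows "(\<Sum>K\<in>rich d R. \<Sum>i\<in>K. real (card {x \<in> big_class d M S K. x i = M})) \<le> real d * real n / real M"
proof -
  let ?a = "\<lambda>K i. card {x \<in> big_class d M S K. x i = M}"
  have finc: "finite (big_class d M S K)" for K using finite_big_class[OF lower fin card_S] .
  have "(\<Sum>K\<in>rich d R. \<Sum>i\<in>K. real (?a K i)) \<le> (\<Sum>K\<in>rich d R. \<Sum>i<d. real (?a K i))"
    by (intro sum_mono sum_mono2) (auto simp: rich_def)
  also have "\<dots> = (\<Sum>i<d. \<Sum>K\<in>rich d R. real (?a K i))" by (rule sum.swap)
  also have "\<dots> \<le> (\<Sum>i<d. real n / real M)"
  proof (rule sum_mono)
    fix i
    have "(\<Sum>K\<in>rich d R. ?a K i) = card (\<Union>K\<in>rich d R. {x \<in> big_class d M S K. x i = M})"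
    proof (rule card_UN_disjoint[symmetric])
      show "\<forall>K\<in>rich d R. finite {x \<in> big_class d M S K. x i = M}" using finc by simp
    qed (auto simp: big_class_def)
    also have "\<dots> \<le> card {x \<in> S. x i = M}"
      by (rule card_mono) (auto simp: fin big_class_def)
    finally have "M * (\<Sum>K\<in>rich d R. ?a K i) \<le> n"
      using mult_card_coord_eq_le[OF lower fin card_S, of M i] order_trans[OF mult_le_mono2] by blast
    then have "real M * (\<Sum>K\<in>rich d R. real (?a K i)) \<le> real n"
      by (simp flip: of_nat_sum of_nat_mult)
    then show "(\<Sum>K\<in>rich d R. real (?a K i)) \<le> real n / real M"
      using assms by (simp add: field_simps)
  qed
  finally show ?thesis by simp
qed

text \<open>In a class K the best pair costs half of 3/|K| times the boundary sum of K, and 1/|K|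
  \<le> R/d. Summed over K the boundaries amount to at most d n/M, so d cancels. For the number of
  slices there are at most 2^d classes with at most n/M^2 labels each.\<close>

lemma level_cover:
  assumes d: "d \<ge> 2" and M: "M > 0" and R: "R > 0"
  shows "\<exists>A\<subseteq>slice_index d n. finite A \<and> real (card A) * (real M)\<^sup>2 \<le> 2 ^ d * real n
     \<and> (\<Sum>f\<in>A. sqrt (real (card (glue f -` S)))) \<le> 3 / 2 * R * real n / real M
     \<and> (\<forall>x\<in>S. big d M x \<in> rich d R \<longrightarrow> (\<exists>f\<in>A. x \<in> range (glue f)))"
proof -
  let ?a = "\<lambda>K i. real (card {x \<in> big_class d M S K. x i = M})"
  define P where "P = (\<lambda>K ij. fst ij \<in> K \<and> snd ij \<in> K \<and> fst ij \<noteq> snd ij \<and>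
     ?a K (fst ij) + ?a K (snd ij) \<le> 3 / real (card K) * (\<Sum>i\<in>K. ?a K i))"
  have "\<forall>K\<in>rich d R. \<exists>ij. P K ij"
  proof
    fix K assume K: "K \<in> rich d R"
    have "finite K" "card K \<ge> 2" using K finite_subset by (auto simp: rich_def)
    then obtain i j where "i \<in> K" "j \<in> K" "i \<noteq> j" "?a K i + ?a K j \<le> 3 / real (card K) * (\<Sum>i\<in>K. ?a K i)"
      using exists_small_pair[of K "?a K"] by auto
    then have "P K (i, j)" by (simp add: P_def)
    then show "\<exists>ij. P K ij" ..
  qed
  then obtain ij where "\<forall>K\<in>rich d R. P K (ij K)" by (rule bchoice[THEN exE])
  then have ij: "fst (ij K) \<in> K" "snd (ij K) \<in> K" "fst (ij K) \<noteq> snd (ij K)"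
     "?a K (fst (ij K)) + ?a K (snd (ij K)) \<le> 3 / real (card K) * (\<Sum>i\<in>K. ?a K i)"
    if "K \<in> rich d R" for K using that by (auto simp: P_def)
  define B where "B = (\<lambda>K. class_base d M S K (fst (ij K)) (snd (ij K)))"
  define idx where "idx = (\<lambda>K z :: nat \<Rightarrow> nat. (M, fst (ij K), snd (ij K), z))"
  define A where "A = (\<Union>K\<in>rich d R. idx K ` B K)"
  have finB: "finite (B K)" for K unfolding B_def by (rule finite_class_base[OF lower fin card_S])
  have injidx: "inj_on (idx K) (B K)" for K by (auto simp: inj_on_def idx_def)
  have "A \<subseteq> slice_index d n"
  proof
    fix f assume "f \<in> A"
    then obtain K z where K: "K \<in> rich d R" and z: "z \<in> B K" and f: "f = idx K z" by (auto simp: A_def)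
    obtain x where x: "x \<in> S" "big d M x = K" "z = x(fst (ij K) := 0, snd (ij K) := 0)"
      using z by (auto simp: B_def class_base_def big_class_def)
    have "M \<le> x (fst (ij K))" "fst (ij K) < d" "snd (ij K) < d"
      using ij(1,2)[OF K] x(2) by (auto simp: big_def)
    moreover have lt: "x l < n" for l using lower_set_coord_less[OF lower fin x(1)] card_S by simp
    moreover have "z \<in> lattice_pts d" using lower_set_zero[OF lower x(1)] by (simp add: x(3) lattice_pts_def)
    moreover have "z l < n" for l using lt[of l] by (simp add: x(3))
    ultimately show "f \<in> slice_index d n"
      unfolding f idx_def slice_index_def using ij(3)[OF K] le_less_trans by fastforce
  qed
  moreover have "finite A" unfolding A_def using finB by simp
  moreover have "real (card A) * (real M)\<^sup>2 \<le> 2 ^ d * real n"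
  proof -
    have "card A * M\<^sup>2 \<le> (\<Sum>K\<in>rich d R. card (idx K ` B K)) * M\<^sup>2"
      unfolding A_def by (intro mult_right_mono card_UN_le) auto
    also have "\<dots> = (\<Sum>K\<in>rich d R. card (B K) * M\<^sup>2)"
      by (simp add: card_image[OF injidx] sum_distrib_right)
    also have "\<dots> \<le> (\<Sum>K\<in>rich d R. n)"
      unfolding B_def by (intro sum_mono card_class_base_mult_le[OF lower fin card_S] ij)
    also have "\<dots> \<le> 2 ^ d * n" using card_rich_le by simp
    finally have "real (card A * M\<^sup>2) \<le> real (2 ^ d * n)" by (rule of_nat_mono)
    then show ?thesis by simp
  qed
  moreover have "(\<Sum>f\<in>A. sqrt (real (card (glue f -` S)))) \<le> 3 / 2 * R * real n / real M"
  proof -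
    have "(\<Sum>f\<in>A. sqrt (real (card (glue f -` S))))
        \<le> (\<Sum>K\<in>rich d R. \<Sum>f\<in>idx K ` B K. sqrt (real (card (glue f -` S))))"
      unfolding A_def by (rule sum_UN_le) (use finB in auto)
    also have "\<dots> \<le> (\<Sum>K\<in>rich d R. (3 / 2 * R / real d) * (\<Sum>i\<in>K. ?a K i))"
    proof (rule sum_mono)
      fix K assume K: "K \<in> rich d R"
      have "(\<Sum>f\<in>idx K ` B K. sqrt (real (card (glue f -` S))))
          = (\<Sum>z\<in>B K. sqrt (real (card (glue (M, fst (ij K), snd (ij K), z) -` S))))"
        by (subst sum.reindex[OF injidx]) (simp add: idx_def)
      also have "\<dots> \<le> (?a K (fst (ij K)) + ?a K (snd (ij K))) / 2"
        unfolding B_def by (rule sum_sqrt_class_le[OF lower fin card_S ij(1-3)[OF K]])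
      also have "\<dots> \<le> (3 / real (card K) * (\<Sum>i\<in>K. ?a K i)) / 2"
        using ij(4)[OF K] by (rule divide_right_mono) simp
      also have "\<dots> = (3 / 2 * (1 / real (card K))) * (\<Sum>i\<in>K. ?a K i)" by simp
      also have "\<dots> \<le> (3 / 2 * R / real d) * (\<Sum>i\<in>K. ?a K i)"
      proof (rule mult_right_mono)
        have "card K > 0" "real d \<le> R * real (card K)" using K by (auto simp: rich_def)
        then have "1 / real (card K) \<le> R / real d" using d by (simp add: field_simps)
        then show "3 / 2 * (1 / real (card K)) \<le> 3 / 2 * R / real d" by simp
      qed (intro sum_nonneg, simp)
      finally show "(\<Sum>f\<in>idx K ` B K. sqrt (real (card (glue f -` S))))
         \<le> (3 / 2 * R / real d) * (\<Sum>i\<in>K. ?a K i)" .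
    qed
    also have "\<dots> = (3 / 2 * R / real d) * (\<Sum>K\<in>rich d R. \<Sum>i\<in>K. ?a K i)"
      by (simp add: sum_distrib_left)
    also have "\<dots> \<le> (3 / 2 * R / real d) * (real d * real n / real M)"
      by (rule mult_left_mono[OF sum_class_boundary_le[OF M]]) (use R in simp)
    also have "\<dots> = 3 / 2 * R * real n / real M" using d by simp
    finally show ?thesis .
  qed
  moreover have "\<exists>f\<in>A. x \<in> range (glue f)" if x: "x \<in> S" and K: "big d M x \<in> rich d R" for x
  proof -
    define K where "K = big d M x"
    have KR: "K \<in> rich d R" using K by (simp add: K_def)
    let ?i = "fst (ij K)" and ?j = "snd (ij K)"
    define z where "z = x(?i := 0, ?j := 0)"
    have "z \<in> B K" unfolding z_def B_def class_base_def big_class_def K_def using x by blast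
    then have "idx K z \<in> A" using KR by (auto simp: A_def)
    moreover have "M \<le> x ?i" "M \<le> x ?j" using ij(1,2)[OF KR] by (auto simp: K_def big_def)
    then have "glue (idx K z) (x ?i - M, x ?j - M) = x"
      using ij(3)[OF KR] by (auto simp: idx_def z_def fun_eq_iff)
    ultimately show ?thesis by (metis rangeI)
  qed
  ultimately show ?thesis by (intro exI[of _ A] conjI ballI impI) simp_all
qed

end

section \<open>Points with few large coordinates\<close>

lemma sum_half_powers_le: "(\<Sum>l\<le>d. (1 / 2 :: real) ^ l) \<le> 2"
proof -
  have "(\<Sum>l\<le>d. (1 / 2 :: real) ^ l) = 2 - (1 / 2) ^ d"
    by (induction d) (auto simp: algebra_simps)
  then show ?thesis by simp
qed

definition level_count :: "nat \<Rightarrow> nat \<Rightarrow> nat \<Rightarrow> nat" where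
  "level_count d m a = card {l. l \<le> d \<and> m * 4 ^ l \<le> a}"

text \<open>The labels of the slices for points that no level handles. The permitted numbers of
  large coordinates decay geometrically and sum to at most d/3 over the levels; at level d the bound
  excludes every large coordinate, so finitely many levels suffice.\<close>

definition poor :: "nat \<Rightarrow> nat \<Rightarrow> nat \<Rightarrow> nat \<Rightarrow> (nat \<Rightarrow> nat) set" where
  "poor d m k j = {z \<in> lattice_pts d. z k = 0 \<and> z j = 0 \<and> (\<forall>l\<le>d. 6 * 2 ^ l * card (big d (m * 4 ^ l) z) \<le> d)}"

text \<open>The values below m weigh at most m. The block from m*4^e to m*4^(e+1) has 3m*4^e values
  of weight at most 8^-(e+1), that is (3/8) m 2^-e in total, and these sum to less than (3/4)
  m.\<close>

lemma sum_level_count_weight_le: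
  assumes "e \<le> d"
  shows "(\<Sum>a<m * 4 ^ e. (1 / 8 :: real) ^ level_count d m a) \<le> real m * (7 / 4 - 3 / 4 / 2 ^ e)"
  using assms
proof (induction e)
  case 0
  have "(\<Sum>a<m * 4 ^ 0. (1 / 8 :: real) ^ level_count d m a) \<le> (\<Sum>a<m * 4 ^ 0. 1)"
    by (intro sum_mono power_le_one) auto
  then show ?case by simp
next
  case (Suc e)
  let ?f = "\<lambda>a. (1 / 8 :: real) ^ level_count d m a"
  have "m * 4 ^ e \<le> m * 4 ^ Suc e" by simp
  then have "(\<Sum>a<m * 4 ^ Suc e. ?f a) = (\<Sum>a<m * 4 ^ e. ?f a) + (\<Sum>a=m * 4 ^ e..<m * 4 ^ Suc e. ?f a)"
    unfolding lessThan_atLeast0 by (rule sum.atLeastLessThan_concat[symmetric, OF le0])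
  also have "(\<Sum>a=m * 4 ^ e..<m * 4 ^ Suc e. ?f a) \<le> (\<Sum>a=m * 4 ^ e..<m * 4 ^ Suc e. (1 / 8) ^ Suc e)"
  proof (rule sum_mono)
    fix a assume a: "a \<in> {m * 4 ^ e..<m * 4 ^ Suc e}"
    have "{..e} \<subseteq> {l. l \<le> d \<and> m * 4 ^ l \<le> a}"
    proof
      fix l assume "l \<in> {..e}"
      then have "m * 4 ^ l \<le> m * 4 ^ e" "l \<le> d" using Suc.prems by (auto intro: power_increasing)
      then show "l \<in> {l. l \<le> d \<and> m * 4 ^ l \<le> a}" using a order_trans[of "m * 4 ^ l" "m * 4 ^ e" a] by simp
    qed
    then have "card {..e} \<le> level_count d m a" unfolding level_count_def by (rule card_mono[rotated]) simp
    then show "?f a \<le> (1 / 8) ^ Suc e" by (intro power_decreasing) auto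
  qed
  also have "\<dots> = real (m * 4 ^ Suc e - m * 4 ^ e) * (1 / 8) ^ Suc e" by simp
  also have "m * 4 ^ Suc e - m * 4 ^ e = 3 * m * 4 ^ e" by simp
  also have "real (3 * m * 4 ^ e) * (1 / 8) ^ Suc e = real m * (3 / 8 / 2 ^ e)"
  proof -
    have "(4::real) ^ e * (1 / 8) ^ e = 1 / 2 ^ e"
      unfolding power_mult_distrib[symmetric] by (simp add: power_divide)
    then show ?thesis by (simp add: mult.assoc)
  qed
  also have "(\<Sum>a<m * 4 ^ e. ?f a) \<le> real m * (7 / 4 - 3 / 4 / 2 ^ e)" using Suc by simp
  finally have "(\<Sum>a<m * 4 ^ Suc e. ?f a) \<le> real m * (7 / 4 - 3 / 4 / 2 ^ e) + real m * (3 / 8 / 2 ^ e)"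
    by simp
  also have "\<dots> = real m * (7 / 4 - 3 / 4 / 2 ^ Suc e)" by (simp add: algebra_simps)
  finally show ?case .
qed

text \<open>Double counting of the pairs of a coordinate i and a level l with m*4^l \<le> z_i.
  Coordinates outside I vanish and, as m > 0, reach no threshold.\<close>

lemma sum_level_count_eq_sum_card_big:
  assumes "I \<subseteq> {..<d}" "\<And>i. i < d \<Longrightarrow> i \<notin> I \<Longrightarrow> z i = 0" "m > 0"
  shows "(\<Sum>i\<in>I. level_count d m (z i)) = (\<Sum>l\<le>d. card (big d (m * 4 ^ l) z))"
proof -
  have finI: "finite I" using assms(1) finite_subset by blast
  have "(\<Sum>i\<in>I. level_count d m (z i)) = (\<Sum>i\<in>I. \<Sum>l\<le>d. if m * 4 ^ l \<le> z i then 1 else 0)"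
  proof (rule sum.cong[OF refl])
    fix i
    have "{l. l \<le> d \<and> m * 4 ^ l \<le> z i} = {l \<in> {..d}. m * 4 ^ l \<le> z i}" by auto
    then show "level_count d m (z i) = (\<Sum>l\<le>d. if m * 4 ^ l \<le> z i then 1 else 0)"
      unfolding level_count_def by (simp add: sum.If_cases Int_def)
  qed
  also have "\<dots> = (\<Sum>l\<le>d. \<Sum>i\<in>I. if m * 4 ^ l \<le> z i then 1 else 0)" by (rule sum.swap)
  also have "\<dots> = (\<Sum>l\<le>d. card (big d (m * 4 ^ l) z))"
  proof (rule sum.cong[OF refl])
    fix l
    have "big d (m * 4 ^ l) z = {i \<in> I. m * 4 ^ l \<le> z i}"
      unfolding big_def using assms by (auto intro: ccontr)
    then show "(\<Sum>i\<in>I. if m * 4 ^ l \<le> z i then 1 else 0) = card (big d (m * 4 ^ l) z)"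
      using finI by (simp add: sum.If_cases Int_def)
  qed
  finally show ?thesis .
qed

lemma sum_card_big_le_of_poor:
  assumes "z \<in> poor d m k j"
  shows "3 * (\<Sum>l\<le>d. card (big d (m * 4 ^ l) z)) \<le> d"
proof -
  have "real (card (big d (m * 4 ^ l) z)) \<le> real d / 6 * (1 / 2) ^ l" if "l \<le> d" for l
  proof -
    have "6 * 2 ^ l * card (big d (m * 4 ^ l) z) \<le> d" using assms that by (simp add: poor_def)
    then have "real (6 * 2 ^ l * card (big d (m * 4 ^ l) z)) \<le> real d" by (rule of_nat_mono)
    then show ?thesis by (simp add: field_simps power_divide)
  qed
  then have "(\<Sum>l\<le>d. real (card (big d (m * 4 ^ l) z))) \<le> (\<Sum>l\<le>d. real d / 6 * (1 / 2) ^ l)"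
    by (intro sum_mono) auto
  also have "\<dots> = real d / 6 * (\<Sum>l\<le>d. (1 / 2) ^ l)" by (simp add: sum_distrib_left)
  also have "\<dots> \<le> real d / 6 * 2"
    by (rule mult_left_mono[OF sum_half_powers_le]) simp
  finally have "real (3 * (\<Sum>l\<le>d. card (big d (m * 4 ^ l) z))) \<le> real d" by simp
  then show ?thesis by (simp only: of_nat_le_iff)
qed

text \<open>Weighting a coordinate $a$ by $8^{-\mathit{level}(a)}$ makes the total weight of one coordinate
  at most $2m$, whereas every poor point has weight at least $2^{-d}$.\<close>
lemma card_poor_le:
  assumes m: "m > 0" and kj: "k < d" "j < d" "k \<noteq> j"
  shows "finite (poor d m k j)" "real (card (poor d m k j)) \<le> 2 ^ d * (2 * real m) ^ (d - 2)"
proof -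
  define I where "I = {..<d} - {k, j}"
  define D where "D = m * 4 ^ d"
  have I: "I \<subseteq> {..<d}" "finite I" by (auto simp: I_def)
  have cI: "card I = d - 2" using kj unfolding I_def by (subst card_Diff_subset) auto
  let ?P = "poor d m k j" and ?\<rho> = "\<lambda>z :: nat \<Rightarrow> nat. restrict z I"
  have off: "z i = 0" if "z \<in> ?P" "i \<notin> I" for z i
    using that by (cases "i < d") (auto simp: poor_def I_def lattice_pts_def)
  have inj: "inj_on ?\<rho> ?P"
  proof (rule inj_onI)
    fix z z' assume z: "z \<in> ?P" "z' \<in> ?P" and eq: "?\<rho> z = ?\<rho> z'"
    show "z = z'"
    proof
      fix i show "z i = z' i"
        using fun_cong[OF eq, of i] off[OF z(1), of i] off[OF z(2), of i] by (cases "i \<in> I") auto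
    qed
  qed
  have sub: "?\<rho> ` ?P \<subseteq> I \<rightarrow>\<^sub>E {..<D}"
  proof
    fix g assume "g \<in> ?\<rho> ` ?P"
    then obtain z where z: "z \<in> ?P" "g = ?\<rho> z" by blast
    have "z i < D" if i: "i \<in> I" for i
    proof (rule ccontr)
      assume "\<not> z i < D"
      then have "i \<in> big d (m * 4 ^ d) z" using i I(1) by (auto simp: big_def D_def)
      then have "card (big d (m * 4 ^ d) z) > 0" by (auto simp: card_gt_0_iff)
      \<comment> \<open>One coordinate above the last threshold would already force 6*2^d \<le>
        d.\<close>
      then have "6 * 2 ^ d * 1 \<le> 6 * 2 ^ d * card (big d (m * 4 ^ d) z)" by (intro mult_le_mono2) simp
      also have "\<dots> \<le> d" using z(1) by (simp add: poor_def)
      finally show False using less_exp[of d] by linarith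
    qed
    then show "g \<in> I \<rightarrow>\<^sub>E {..<D}" using z(2) by auto
  qed
  have finE: "finite (I \<rightarrow>\<^sub>E {..<D})" using I by (simp add: finite_PiE)
  show fin: "finite ?P" using finite_imageD[OF finite_subset[OF sub finE] inj] .
  let ?w = "\<lambda>g. \<Prod>i\<in>I. (1 / 8 :: real) ^ level_count d m (g i)"
  have "real (card ?P) * (1 / 2) ^ d = (\<Sum>z\<in>?P. (1 / 2) ^ d)" by simp
  also have "\<dots> \<le> (\<Sum>z\<in>?P. ?w (?\<rho> z))"
  proof (rule sum_mono)
    fix z assume z: "z \<in> ?P"
    define s where "s = (\<Sum>i\<in>I. level_count d m (z i))"
    have s: "s = (\<Sum>l\<le>d. card (big d (m * 4 ^ l) z))"
      unfolding s_def by (rule sum_level_count_eq_sum_card_big[OF I(1) _ m]) (rule off[OF z])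
    have "?w (?\<rho> z) = (1 / 8) ^ s" unfolding s_def power_sum by (rule prod.cong) auto
    also have "\<dots> = (1 / 2) ^ (3 * s)" by (simp add: power_mult power3_eq_cube)
    also have "\<dots> \<ge> (1 / 2) ^ d"
      using sum_card_big_le_of_poor[OF z] unfolding s by (intro power_decreasing) auto
    finally show "(1 / 2) ^ d \<le> ?w (?\<rho> z)" .
  qed
  also have "\<dots> = (\<Sum>g\<in>?\<rho> ` ?P. ?w g)" by (simp add: sum.reindex[OF inj])
  also have "\<dots> \<le> (\<Sum>g\<in>I \<rightarrow>\<^sub>E {..<D}. ?w g)"
    by (rule sum_mono2[OF finE sub]) (intro prod_nonneg, simp)
  also have "\<dots> = (\<Prod>i\<in>I. \<Sum>a<D. (1 / 8) ^ level_count d m a)"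
    by (rule prod_sum_PiE[symmetric]) (use I in auto)
  also have "\<dots> = (\<Sum>a<D. (1 / 8) ^ level_count d m a) ^ (d - 2)" by (simp add: cI)
  also have "\<dots> \<le> (2 * real m) ^ (d - 2)"
  proof (rule power_mono)
    have "(\<Sum>a<D. (1 / 8 :: real) ^ level_count d m a) \<le> real m * (7 / 4 - 3 / 4 / 2 ^ d)"
      unfolding D_def by (rule sum_level_count_weight_le) simp
    also have "\<dots> \<le> real m * 2" by (intro mult_left_mono) (auto simp: field_simps)
    finally show "(\<Sum>a<D. (1 / 8 :: real) ^ level_count d m a) \<le> 2 * real m" by simp
  qed (intro sum_nonneg, simp)
  finally have "real (card ?P) * (1 / 2) ^ d * 2 ^ d \<le> (2 * real m) ^ (d - 2) * 2 ^ d"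
    by (intro mult_right_mono) auto
  moreover have "(1 / 2 :: real) ^ d * 2 ^ d = 1" by (simp flip: power_mult_distrib)
  ultimately show "real (card ?P) \<le> 2 ^ d * (2 * real m) ^ (d - 2)"
    by (simp only: mult.assoc mult_1_right mult.commute[of "2 ^ d"])
qed

text \<open>Take k to be a largest coordinate. A level fails to be rich either because K is small
  compared with d, which is what \<open>poor\<close> asks for, or because K has at most one element;
  such an element attains the maximum, and zeroing k leaves no large coordinate. The direction j
  only completes the plane; tying it to k keeps the number of pairs at d.\<close>

lemma poor_of_not_rich:
  assumes d: "d \<ge> 2" and m: "m > 0" and x: "x \<in> lattice_pts d"
    and nr: "\<And>l. l \<le> d \<Longrightarrow> big d (m * 4 ^ l) x \<notin> rich d (6 * 2 ^ l)"
  obtains k where "k < d" "x(k := 0, (if k = 0 then 1 else 0) := 0) \<in> poor d m k (if k = 0 then 1 else 0)"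
proof -
  have "{..<d} \<noteq> {}" using d by (simp add: lessThan_empty_iff)
  then have "Max (x ` {..<d}) \<in> x ` {..<d}" by (intro Max_in) auto
  then obtain k where k': "k < d" "x k = Max (x ` {..<d})" by auto
  then have k: "k < d" "\<And>i. i < d \<Longrightarrow> x i \<le> x k" by auto
  define j :: nat where "j = (if k = 0 then 1 else 0)"
  define z where "z = x(k := 0, j := 0)"
  have "6 * 2 ^ l * card (big d (m * 4 ^ l) z) \<le> d" if l: "l \<le> d" for l
  proof -
    let ?M = "m * 4 ^ l" and ?B = "big d (m * 4 ^ l) x" and ?B' = "big d (m * 4 ^ l) z"
    have M: "?M > 0" using m by simp
    have sub: "?B' \<subseteq> ?B - {k}"
    proof
      fix i assume i: "i \<in> ?B'"
      then have iM: "i < d" "?M \<le> z i" by (auto simp: big_def)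
      then have "z i \<noteq> 0" using M by linarith
      moreover have "z k = 0" "z j = 0" by (simp_all add: z_def)
      ultimately have "i \<noteq> k" "i \<noteq> j" by metis+
      then show "i \<in> ?B - {k}" using iM by (auto simp: big_def z_def)
    qed
    show ?thesis
    proof (cases "card ?B \<ge> 2")
      case True
      then have "\<not> real d \<le> 6 * 2 ^ l * real (card ?B)"
        using nr[OF l] big_subset[of d ?M x] by (simp add: rich_def)
      then have "real (6 * 2 ^ l * card ?B) \<le> real d" by simp
      then have "6 * 2 ^ l * card ?B \<le> d" by (simp only: of_nat_le_iff)
      moreover have "card ?B' \<le> card ?B" by (rule card_mono) (use sub in auto)
      ultimately show ?thesis by (meson le_trans mult_le_mono2)
    next
      case False
      have "?B' = {}"
      proof (rule ccontr)
        assume "?B' \<noteq> {}"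
        then obtain i where i: "i \<in> ?B" "i \<noteq> k" using sub by auto
        then have "?M \<le> x k" using k(2)[of i] by (simp add: big_def)
        then have "{i, k} \<subseteq> ?B" using i k(1) by (auto simp: big_def)
        then have "card {i, k} \<le> card ?B" by (rule card_mono[rotated]) simp
        then show False using i(2) False by simp
      qed
      then show ?thesis by simp
    qed
  qed
  moreover have "z \<in> lattice_pts d" using x by (simp add: z_def lattice_pts_def)
  ultimately have "z \<in> poor d m k j" by (simp add: poor_def z_def)
  then show ?thesis using that[OF k(1)] unfolding z_def j_def by blast
qed

context
  fixes d n :: nat and S :: "(nat \<Rightarrow> nat) set"
  assumes lower: "is_lower_set d S" and fin: "finite S" and card_S: "card S = n"
begin

text \<open>Here the directions are fixed and the slices start at 0. They are disjoint and hold at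
  most n points together, so Cauchy--Schwarz turns at most V labels into cost sqrt (V n).\<close>

lemma poor_cover:
  assumes m: "m > 0" and kj: "k < d" "j < d" "k \<noteq> j"
  defines "V \<equiv> 2 ^ d * (2 * real m) ^ (d - 2)"
  shows "\<exists>A\<subseteq>slice_index d n. finite A \<and> real (card A) \<le> V
     \<and> (\<Sum>f\<in>A. sqrt (real (card (glue f -` S)))) \<le> sqrt (V * real n)
     \<and> (\<forall>x\<in>S. x(k := 0, j := 0) \<in> poor d m k j \<longrightarrow> (\<exists>f\<in>A. x \<in> range (glue f)))"
proof -
  define B where "B = poor d m k j \<inter> (\<lambda>x. x(k := 0, j := 0)) ` S"
  define idx where "idx = (\<lambda>z :: nat \<Rightarrow> nat. (0 :: nat, k, j, z))"
  define A where "A = idx ` B"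
  have finB: "finite B" using fin by (simp add: B_def)
  have injidx: "inj_on idx B" by (auto simp: inj_on_def idx_def)
  have B0: "z k = 0" "z j = 0" if "z \<in> B" for z using that by (auto simp: B_def)
  have "card B \<le> card (poor d m k j)"
    unfolding B_def by (rule card_mono[OF card_poor_le(1)[OF m kj]]) simp
  then have cB: "real (card B) \<le> V"
    using card_poor_le(2)[OF m kj] unfolding V_def by linarith
  have "A \<subseteq> slice_index d n"
  proof
    fix f assume "f \<in> A"
    then obtain x where x: "x \<in> S" and f: "f = idx (x(k := 0, j := 0))" by (auto simp: A_def B_def)
    have lt: "x l < n" for l using lower_set_coord_less[OF lower fin x] card_S by simp
    then have n: "0 < n" using lt[of 0] by linarith
    moreover have "x l = 0" if "l \<ge> d" for l using lower_set_zero[OF lower x that] .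
    ultimately show "f \<in> slice_index d n"
      unfolding f idx_def slice_index_def lattice_pts_def using kj lt by simp
  qed
  moreover have "finite A" using finB by (simp add: A_def)
  moreover have "real (card A) \<le> V" using cB by (simp add: A_def card_image[OF injidx])
  moreover have "(\<Sum>f\<in>A. sqrt (real (card (glue f -` S)))) \<le> sqrt (V * real n)"
  proof -
    let ?t = "\<lambda>z. card (glue (idx z) -` S)"
    have fint: "finite (glue (idx z) -` S)" for z
      using young_glue_vimage[OF lower fin kj(3)] by (simp add: idx_def youngs_upto_def)
    have "(\<Sum>z\<in>B. ?t z) = card (SIGMA z:B. glue (idx z) -` S)"
      using finB fint by (simp add: card_SigmaI)
    also have "\<dots> \<le> card S"
    proof (rule card_inj_on_le[OF _ _ fin])
      show "inj_on (\<lambda>(z, u). glue (idx z) u) (SIGMA z:B. glue (idx z) -` S)"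
      proof (rule inj_onI, clarify, goal_cases)
        case (1 z a b z' a' b')
        then have z: "z \<in> B" "z' \<in> B" and eq: "z(k := a, j := b) = z'(k := a', j := b')"
          by (auto simp: idx_def)
        have "b = b'" "a = a'" using fun_cong[OF eq, of j] fun_cong[OF eq, of k] kj(3) by auto
        moreover have "z l = z' l" for l
          using fun_cong[OF eq, of l] B0[OF z(1)] B0[OF z(2)] kj(3)
          by (cases "l = k"; cases "l = j") auto
        ultimately show ?case by auto
      qed
    qed auto
    finally have sum_t: "(\<Sum>z\<in>B. real (?t z)) \<le> real n" using card_S by (simp flip: of_nat_sum)
    have eq: "(\<Sum>f\<in>A. sqrt (real (card (glue f -` S)))) = (\<Sum>z\<in>B. sqrt (real (?t z)))"
      unfolding A_def by (simp add: sum.reindex[OF injidx])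
    have "(\<Sum>z\<in>B. sqrt (real (?t z)))\<^sup>2 \<le> (\<Sum>z\<in>B. (sqrt (real (?t z)))\<^sup>2) * real (card B)"
      by (rule sum_squared_le_sum_of_squares)
    then have "(\<Sum>z\<in>B. sqrt (real (?t z)))\<^sup>2 \<le> (\<Sum>z\<in>B. real (?t z)) * real (card B)" by simp
    also have "\<dots> \<le> real n * V"
      by (rule mult_mono[OF sum_t cB]) auto
    finally have "(\<Sum>z\<in>B. sqrt (real (?t z))) \<le> sqrt (V * real n)"
      by (intro real_le_rsqrt) (simp add: mult.commute)
    then show ?thesis unfolding eq .
  qed
  moreover have "\<exists>f\<in>A. x \<in> range (glue f)" if x: "x \<in> S" and P: "x(k := 0, j := 0) \<in> poor d m k j" for x
  proof -
    have "idx (x(k := 0, j := 0)) \<in> A" using x P by (auto simp: A_def B_def)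
    moreover have "glue (idx (x(k := 0, j := 0))) (x k, x j) = x"
      using kj(3) by (auto simp: idx_def fun_eq_iff)
    ultimately show ?thesis by (metis rangeI)
  qed
  ultimately show ?thesis by (intro exI[of _ A] conjI ballI impI) simp_all
qed

lemma lower_set_cover:
  assumes d: "d \<ge> 2" and m: "m > 0"
  defines "V \<equiv> 2 ^ d * (2 * real m) ^ (d - 2)"
  shows "\<exists>A\<subseteq>slice_index d n. real (card A) \<le> (real d + 1) * 2 ^ d * real n / (real m)\<^sup>2 + real d * V
     \<and> (\<forall>f\<in>A. glue f -` S \<in> youngs_upto n)
     \<and> (\<Sum>f\<in>A. sqrt (real (card (glue f -` S)))) \<le> 18 * real n / real m + real d * sqrt (V * real n)
     \<and> S = (\<Union>f\<in>A. glue f ` (glue f -` S))"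
proof -
  let ?w = "\<lambda>f. sqrt (real (card (glue f -` S)))"
  define jj where "jj = (\<lambda>k :: nat. if k = 0 then 1 else 0 :: nat)"
  have jj: "jj k < d" "k \<noteq> jj k" for k using d by (auto simp: jj_def)
  have "\<forall>l\<in>{..d}. \<exists>A. A \<subseteq> slice_index d n \<and> finite A \<and> real (card A) * (real (m * 4 ^ l))\<^sup>2 \<le> 2 ^ d * real n
     \<and> (\<Sum>f\<in>A. ?w f) \<le> 3 / 2 * (6 * 2 ^ l) * real n / real (m * 4 ^ l)
     \<and> (\<forall>x\<in>S. big d (m * 4 ^ l) x \<in> rich d (6 * 2 ^ l) \<longrightarrow> (\<exists>f\<in>A. x \<in> range (glue f)))"
    by (intro ballI level_cover[OF lower fin card_S d]) (use m in auto)
  then obtain A1 where "\<forall>l\<in>{..d}. A1 l \<subseteq> slice_index d n \<and> finite (A1 l) \<and> real (card (A1 l)) * (real (m * 4 ^ l))\<^sup>2 \<le> 2 ^ d * real n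
     \<and> (\<Sum>f\<in>A1 l. ?w f) \<le> 3 / 2 * (6 * 2 ^ l) * real n / real (m * 4 ^ l)
     \<and> (\<forall>x\<in>S. big d (m * 4 ^ l) x \<in> rich d (6 * 2 ^ l) \<longrightarrow> (\<exists>f\<in>A1 l. x \<in> range (glue f)))"
    by (rule bchoice[THEN exE])
  then have A1: "A1 l \<subseteq> slice_index d n" "finite (A1 l)" "real (card (A1 l)) * (real (m * 4 ^ l))\<^sup>2 \<le> 2 ^ d * real n"
     "(\<Sum>f\<in>A1 l. ?w f) \<le> 3 / 2 * (6 * 2 ^ l) * real n / real (m * 4 ^ l)"
     "\<And>x. x \<in> S \<Longrightarrow> big d (m * 4 ^ l) x \<in> rich d (6 * 2 ^ l) \<Longrightarrow> \<exists>f\<in>A1 l. x \<in> range (glue f)"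
    if "l \<in> {..d}" for l using that by auto
  have "\<forall>k\<in>{..<d}. \<exists>A. A \<subseteq> slice_index d n \<and> finite A \<and> real (card A) \<le> V
     \<and> (\<Sum>f\<in>A. ?w f) \<le> sqrt (V * real n)
     \<and> (\<forall>x\<in>S. x(k := 0, jj k := 0) \<in> poor d m k (jj k) \<longrightarrow> (\<exists>f\<in>A. x \<in> range (glue f)))"
    unfolding V_def by (intro ballI poor_cover[OF m]) (use jj in auto)
  then obtain A2 where "\<forall>k\<in>{..<d}. A2 k \<subseteq> slice_index d n \<and> finite (A2 k) \<and> real (card (A2 k)) \<le> V
     \<and> (\<Sum>f\<in>A2 k. ?w f) \<le> sqrt (V * real n)
     \<and> (\<forall>x\<in>S. x(k := 0, jj k := 0) \<in> poor d m k (jj k) \<longrightarrow> (\<exists>f\<in>A2 k. x \<in> range (glue f)))"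
    by (rule bchoice[THEN exE])
  then have A2: "A2 k \<subseteq> slice_index d n" "finite (A2 k)" "real (card (A2 k)) \<le> V"
     "(\<Sum>f\<in>A2 k. ?w f) \<le> sqrt (V * real n)"
     "\<And>x. x \<in> S \<Longrightarrow> x(k := 0, jj k := 0) \<in> poor d m k (jj k) \<Longrightarrow> \<exists>f\<in>A2 k. x \<in> range (glue f)"
    if "k \<in> {..<d}" for k using that by auto
  define U1 where "U1 = (\<Union>l\<in>{..d}. A1 l)"
  define U2 where "U2 = (\<Union>k\<in>{..<d}. A2 k)"
  have finU: "finite U1" "finite U2" using A1(2) A2(2) by (auto simp: U1_def U2_def)
  have sub: "U1 \<union> U2 \<subseteq> slice_index d n" unfolding U1_def U2_def using A1(1) A2(1) by blast
  have card1: "real (card (A1 l)) \<le> 2 ^ d * real n / (real m)\<^sup>2" if l: "l \<in> {..d}" for l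
  proof -
    have "real m * 1 \<le> real m * 4 ^ l" by (intro mult_left_mono) auto
    then have "(real m)\<^sup>2 \<le> (real (m * 4 ^ l))\<^sup>2" by (intro power_mono) auto
    then have "real (card (A1 l)) * (real m)\<^sup>2 \<le> real (card (A1 l)) * (real (m * 4 ^ l))\<^sup>2"
      by (rule mult_left_mono) simp
    also have "\<dots> \<le> 2 ^ d * real n" by (rule A1(3)[OF l])
    finally show ?thesis using m by (simp add: field_simps)
  qed
  have "card U1 \<le> (\<Sum>l\<in>{..d}. card (A1 l))" unfolding U1_def by (rule card_UN_le) simp
  then have "real (card U1) \<le> (\<Sum>l\<in>{..d}. real (card (A1 l)))" by (simp flip: of_nat_sum)
  also have "\<dots> \<le> (\<Sum>l\<in>{..d}. 2 ^ d * real n / (real m)\<^sup>2)" by (rule sum_mono[OF card1])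
  finally have cU1: "real (card U1) \<le> (real d + 1) * 2 ^ d * real n / (real m)\<^sup>2" by (simp add: algebra_simps)
  have "card U2 \<le> (\<Sum>k\<in>{..<d}. card (A2 k))" unfolding U2_def by (rule card_UN_le) simp
  then have "real (card U2) \<le> (\<Sum>k\<in>{..<d}. real (card (A2 k)))" by (simp flip: of_nat_sum)
  also have "\<dots> \<le> (\<Sum>k\<in>{..<d}. V)" by (rule sum_mono[OF A2(3)])
  finally have cU2: "real (card U2) \<le> real d * V" by simp
  have "real (card (U1 \<union> U2)) \<le> real (card U1) + real (card U2)"
    using card_Un_le[of U1 U2] by linarith
  then have c: "real (card (U1 \<union> U2)) \<le> (real d + 1) * 2 ^ d * real n / (real m)\<^sup>2 + real d * V"
    using cU1 cU2 by linarith
  have "(\<Sum>f\<in>U1. ?w f) \<le> (\<Sum>l\<in>{..d}. \<Sum>f\<in>A1 l. ?w f)"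
    unfolding U1_def by (rule sum_UN_le) (use A1(2) in auto)
  also have "\<dots> \<le> (\<Sum>l\<in>{..d}. 9 * real n / real m * (1 / 2) ^ l)"
  proof (rule sum_mono)
    fix l assume l: "l \<in> {..d}"
    have "(4::real) ^ l = 2 ^ l * 2 ^ l" by (simp flip: power_mult_distrib)
    \<comment> \<open>The loss 6*2^l over the threshold m*4^l leaves 9 * 2^-l / m, a convergent
      series over the levels.\<close>
    then have "3 / 2 * (6 * 2 ^ l) * real n / real (m * 4 ^ l) = 9 * real n / real m * (1 / 2) ^ l"
      using m by (simp add: field_simps power_divide)
    then show "(\<Sum>f\<in>A1 l. ?w f) \<le> 9 * real n / real m * (1 / 2) ^ l" using A1(4)[OF l] by linarith
  qed
  also have "\<dots> = 9 * real n / real m * (\<Sum>l\<in>{..d}. (1 / 2) ^ l)" by (simp add: sum_distrib_left)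
  also have "\<dots> \<le> 9 * real n / real m * 2"
    by (rule mult_left_mono[OF sum_half_powers_le]) simp
  finally have w1: "(\<Sum>f\<in>U1. ?w f) \<le> 18 * real n / real m" by simp
  have "(\<Sum>f\<in>U2. ?w f) \<le> (\<Sum>k\<in>{..<d}. \<Sum>f\<in>A2 k. ?w f)"
    unfolding U2_def by (rule sum_UN_le) (use A2(2) in auto)
  also have "\<dots> \<le> (\<Sum>k\<in>{..<d}. sqrt (V * real n))" by (rule sum_mono[OF A2(4)])
  finally have w2: "(\<Sum>f\<in>U2. ?w f) \<le> real d * sqrt (V * real n)" by simp
  have "0 \<le> (\<Sum>f\<in>U1 \<inter> U2. ?w f)" by (rule sum_nonneg) simp
  then have w: "(\<Sum>f\<in>U1 \<union> U2. ?w f) \<le> 18 * real n / real m + real d * sqrt (V * real n)"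
    using sum.union_inter[OF finU, of ?w] w1 w2 by linarith
  have young: "glue f -` S \<in> youngs_upto n" if "f \<in> U1 \<union> U2" for f
  proof -
    obtain \<alpha> i j z where f: "f = (\<alpha>, i, j, z)" by (cases f)
    have "i \<noteq> j" using that sub unfolding f slice_index_def by blast
    then show ?thesis using young_glue_vimage[OF lower fin] card_S unfolding f by blast
  qed
  have cov: "\<exists>f\<in>U1 \<union> U2. x \<in> range (glue f)" if x: "x \<in> S" for x
  proof (cases "\<exists>l\<le>d. big d (m * 4 ^ l) x \<in> rich d (6 * 2 ^ l)")
    case True
    then obtain l where l: "l \<in> {..d}" "big d (m * 4 ^ l) x \<in> rich d (6 * 2 ^ l)" by auto
    then show ?thesis using A1(5)[OF l(1) x l(2)] l(1) unfolding U1_def by blast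
  next
    case False
    have "x \<in> lattice_pts d" using lower x by (auto simp: is_lower_set_def)
    then obtain k where k: "k < d" "x(k := 0, jj k := 0) \<in> poor d m k (jj k)"
      using poor_of_not_rich[OF d m, of x] False unfolding jj_def by metis
    then show ?thesis using A2(5)[of k x] x unfolding U2_def by blast
  qed
  have "S = (\<Union>f\<in>U1 \<union> U2. glue f ` (glue f -` S))"
  proof (rule equalityI)
    show "S \<subseteq> (\<Union>f\<in>U1 \<union> U2. glue f ` (glue f -` S))"
      unfolding image_vimage_eq using cov by blast
  qed auto
  then show ?thesis using sub c w young by (intro exI[of _ "U1 \<union> U2"] conjI ballI)
qed

end

section \<open>The upper bound\<close>

lemma card_lattice_box_le:
  "finite {z \<in> lattice_pts d. \<forall>l. z l < n}" "card {z \<in> lattice_pts d. \<forall>l. z l < n} \<le> n ^ d"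
proof -
  let ?B = "{z \<in> lattice_pts d. \<forall>l. z l < n}" and ?\<rho> = "\<lambda>z :: nat \<Rightarrow> nat. restrict z {..<d}"
  have inj: "inj_on ?\<rho> ?B"
  proof (rule inj_onI)
    fix z z' assume z: "z \<in> ?B" "z' \<in> ?B" and eq: "?\<rho> z = ?\<rho> z'"
    show "z = z'"
    proof
      fix i show "z i = z' i"
        using fun_cong[OF eq, of i] z by (cases "i < d") (auto simp: lattice_pts_def)
    qed
  qed
  have sub: "?\<rho> ` ?B \<subseteq> {..<d} \<rightarrow>\<^sub>E {..<n}"
    by (intro image_subsetI restrict_PiE) auto
  have finE: "finite ({..<d} \<rightarrow>\<^sub>E {..<n})" by (simp add: finite_PiE)
  show "finite ?B" using finite_imageD[OF finite_subset[OF sub finE] inj] .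
  have "card ?B \<le> card ({..<d} \<rightarrow>\<^sub>E {..<n})" by (rule card_inj_on_le[OF inj sub finE])
  then show "card ?B \<le> n ^ d" by (simp add: card_PiE)
qed

lemma card_slice_index_le:
  "finite (slice_index d n)" "card (slice_index d n) \<le> n * (d * (d * n ^ d))"
proof -
  let ?P = "{..<n} \<times> {..<d} \<times> {..<d} \<times> {z \<in> lattice_pts d. \<forall>l. z l < n}"
  have sub: "slice_index d n \<subseteq> ?P" by (auto simp: slice_index_def)
  have fin: "finite ?P" using card_lattice_box_le(1) by (intro finite_cartesian_product) auto
  show "finite (slice_index d n)" using finite_subset[OF sub fin] .
  have "card (slice_index d n) \<le> card ?P" by (rule card_mono[OF fin sub])
  also have "\<dots> = n * (d * (d * card {z \<in> lattice_pts d. \<forall>l. z l < n}))"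
    by (simp add: card_cartesian_product)
  also have "\<dots> \<le> n * (d * (d * n ^ d))" using card_lattice_box_le(2) by (intro mult_le_mono2)
  finally show "card (slice_index d n) \<le> n * (d * (d * n ^ d))" .
qed

text \<open>Naming a slice costs a factor at most n^(d+5): the pool of names with the blank has at
  most n^(d+3) elements because n > d, and n + 1 \<le> n^2 pays for the diagram.\<close>

lemma ln_p_le_of_params:
  assumes d: "d \<ge> 2" and n: "n > d" and m: "m > 0"
  defines "V \<equiv> 2 ^ d * (2 * real m) ^ (d - 2)"
  shows "ln (real (p d n)) \<le> ((real d + 1) * 2 ^ d * real n / (real m)\<^sup>2 + real d * V) * (real (d + 5) * ln (real n))
      + 10 * (18 * real n / real m + real d * sqrt (V * real n))"
proof -
  define X where "X = (real d + 1) * 2 ^ d * real n / (real m)\<^sup>2 + real d * V"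
  define C where "C = 18 * real n / real m + real d * sqrt (V * real n)"
  define Z where "Z = nat \<lfloor>X\<rfloor>"
  have V: "V \<ge> 0" by (simp add: V_def)
  have X: "X \<ge> 0" unfolding X_def using V by simp
  have C: "C \<ge> 0" unfolding C_def using V by simp
  have n2: "real n \<ge> 2" "ln (real n) \<ge> 0" using n d by auto
  define F where "F = slice_index d n"
  have count: "real (p d n) \<le> (real (card F + 1) * real (n + 1)) ^ Z * exp (10 * C)"
    unfolding p_def F_def
  proof (rule card_le_of_slice_covers[where T = "\<lambda>f S. glue f -` S" and g = glue])
    show "finite (slice_index d n)" by (rule card_slice_index_le)
    fix S assume "S \<in> {S. is_lower_set d S \<and> finite S \<and> card S = n}"
    then obtain A where A: "A \<subseteq> slice_index d n" "real (card A) \<le> X" "\<forall>f\<in>A. glue f -` S \<in> youngs_upto n"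
       "(\<Sum>f\<in>A. sqrt (real (card (glue f -` S)))) \<le> C" "S = (\<Union>f\<in>A. glue f ` (glue f -` S))"
      using lower_set_cover[of d S n m] d m unfolding X_def C_def V_def by blast
    have "card A \<le> Z" using A(2) unfolding Z_def by linarith
    then show "\<exists>A\<subseteq>slice_index d n. card A \<le> Z \<and> (\<forall>f\<in>A. glue f -` S \<in> youngs_upto n)
        \<and> (\<Sum>f\<in>A. sqrt (real (card (glue f -` S)))) \<le> C \<and> S = (\<Union>f\<in>A. glue f ` (glue f -` S))"
      using A by (intro exI[of _ A] conjI)
  qed
  have "card F + 1 \<le> n ^ (d + 3)"
  proof -
    have "card F + 1 \<le> n * (d * (d * n ^ d)) + n * n ^ d"
      using card_slice_index_le(2)[of d n] n unfolding F_def
      by (intro add_mono) (auto simp: Suc_le_eq)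
    also have "\<dots> = (d * d + 1) * n ^ (d + 1)" by (simp add: algebra_simps)
    also have "d * d + 1 \<le> n * n"
      using mult_le_mono[of "Suc d" n "Suc d" n] n by (simp add: Suc_le_eq)
    also have "n * n * n ^ (d + 1) = n ^ (d + 3)" by (simp add: numeral_eq_Suc)
    finally show ?thesis by simp
  qed
  then have "real (card F + 1) \<le> real (n ^ (d + 3))" by (rule of_nat_mono)
  then have "real (card F + 1) \<le> real n ^ (d + 3)" unfolding of_nat_power .
  moreover have "real (n + 1) \<le> real n ^ 2"
  proof -
    have "2 * real n \<le> real n * real n" using n2 by (intro mult_right_mono) auto
    moreover have "real (n + 1) \<le> 2 * real n" using n2(1) by simp
    ultimately show ?thesis unfolding power2_eq_square by linarith
  qed
  ultimately have "real (card F + 1) * real (n + 1) \<le> real n ^ (d + 3) * real n ^ 2"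
    by (intro mult_mono) auto
  also have "\<dots> = real n ^ (d + 5)" by (simp add: numeral_eq_Suc)
  finally have "(real (card F + 1) * real (n + 1)) ^ Z \<le> (real n ^ (d + 5)) ^ Z"
    by (intro power_mono) auto
  then have pn: "real (p d n) \<le> (real n ^ (d + 5)) ^ Z * exp (10 * C)"
    by (intro order_trans[OF count] mult_right_mono) auto
  show ?thesis
  proof (cases "p d n = 0")
    case True
    then show ?thesis using X C n2 unfolding X_def[symmetric] C_def[symmetric] by simp
  next
    case False
    then have "ln (real (p d n)) \<le> ln ((real n ^ (d + 5)) ^ Z * exp (10 * C))"
      using pn n2 by (intro ln_mono) auto
    also have "\<dots> = real Z * (real (d + 5) * ln (real n)) + 10 * C"
      using n2 by (simp add: ln_mult ln_realpow)
    also have "real Z * (real (d + 5) * ln (real n)) \<le> X * (real (d + 5) * ln (real n))"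
      using X n2 unfolding Z_def by (intro mult_right_mono) auto
    finally show ?thesis unfolding X_def C_def by simp
  qed
qed

text \<open>Here N is the d-th root of n. The rich slices give 306 = 18 * 17 because m \<ge> N/17,
  the poor ones 4, both multiplied by 10 from the diagram count; naming all slices costs 2400. The
  sum is 5500. The size of N is used for the naming cost, where Q \<le> sqrt N absorbs all factors
  depending on d.\<close>

lemma ln_p_upper:
  fixes N :: real
  assumes d: "d \<ge> 2" and n: "N ^ d = real n" and N: "N \<ge> (30 * real d) ^ (2 * d)"
  shows "ln (real (p d n)) \<le> 5500 * N ^ (d - 1)"
proof -
  obtain k where k: "d = k + 2" using d by (metis add.commute le_Suc_ex)
  define Q where "Q = (30 * real d) ^ d"
  have d2: "real d \<ge> 2" using d by simp
  have Q: "Q \<ge> 3600"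
  proof -
    have "(3600::real) = 60 ^ 2" by simp
    also have "\<dots> \<le> (30 * real d) ^ 2" using d2 by (intro power_mono) auto
    also have "\<dots> \<le> Q" unfolding Q_def using d d2 by (intro power_increasing) auto
    finally show ?thesis .
  qed
  have NQ: "N \<ge> Q\<^sup>2" using N unfolding Q_def power_mult[symmetric] by (simp only: mult.commute)
  have "Q\<^sup>2 \<ge> 3600 * 3600" unfolding power2_eq_square using Q by (intro mult_mono) auto
  then have N0: "N \<ge> 10000" using NQ by simp
  \<comment> \<open>Since 2m \<le> N/8, the factor 2^d in V still leaves V \<le> 4 (N/4)^(d-2). Its
    square root supplies 2^-(d-2), which compensates for the d families of poor slices.\<close>
  define m where "m = nat \<lfloor>N / 16\<rfloor>"
  have m: "m > 0" "real m \<le> N / 16" "real m \<ge> N / 17" using N0 unfolding m_def by linarith+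
  have nd: "n > d"
  proof -
    have "real d \<le> 30 * real d" using d2 by simp
    also have "\<dots> \<le> (30 * real d) ^ (2 * d)" using d2 d by (intro self_le_power) auto
    also have "\<dots> \<le> N" by (rule N)
    also have "\<dots> < N ^ d" using N0 d by (intro power_strict_increasing[of 1 d N, simplified]) auto
    finally show ?thesis using n by simp
  qed
  define V where "V = 2 ^ d * (2 * real m) ^ (d - 2)"
  have nk: "real n = N\<^sup>2 * N ^ k" using n by (simp add: k power2_eq_square mult.assoc)
  have Nk: "N ^ (d - 1) = N * N ^ k" by (simp add: k)
  have V: "V \<le> 4 * (N / 4) ^ k"
  proof -
    have "(2 * real m) ^ k \<le> (N / 8) ^ k" using m by (intro power_mono) auto
    then have "V \<le> 2 ^ d * (N / 8) ^ k" by (simp add: V_def k)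
    also have "\<dots> = 4 * (2 * (N / 8)) ^ k" unfolding power_mult_distrib k by (simp add: power_add)
    finally show ?thesis by simp
  qed
  have V0: "V \<ge> 0" by (simp add: V_def)
  have A: "18 * real n / real m \<le> 306 * N ^ (d - 1)"
  proof -
    have "18 * real n / real m \<le> 18 * real n / (N / 17)"
      using m N0 by (intro divide_left_mono) auto
    also have "\<dots> = 306 * N ^ (d - 1)" using N0 unfolding nk Nk by (simp add: field_simps power2_eq_square)
    finally show ?thesis .
  qed
  have B: "real d * sqrt (V * real n) \<le> 4 * N ^ (d - 1)"
  proof -
    have "V * real n \<le> 4 * (N / 4) ^ k * real n" using V by (intro mult_right_mono) auto
    also have "\<dots> = (2 * N * (N / 2) ^ k)\<^sup>2"
    proof -
      have "(N / 4) ^ k * N ^ k = (N / 2) ^ k * (N / 2) ^ k"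
        unfolding power_mult_distrib[symmetric] by simp
      then show ?thesis unfolding nk by (simp add: power_mult_distrib power2_eq_square mult_ac)
    qed
    finally have "sqrt (V * real n) \<le> 2 * N * (N / 2) ^ k"
      using N0 by (intro real_le_lsqrt) auto
    then have "real d * sqrt (V * real n) \<le> real d * (2 * N * (N / 2) ^ k)" by (intro mult_left_mono) auto
    also have "\<dots> = (real d / 2 ^ k) * (2 * N * N ^ k)" by (simp add: power_divide)
    also have "\<dots> \<le> 2 * (2 * N * N ^ k)"
    proof (rule mult_right_mono)
      have "k + 2 \<le> 2 * 2 ^ k" by (induction k) auto
      then have "real (k + 2) \<le> real (2 * 2 ^ k)" by (rule of_nat_mono)
      then show "real d / 2 ^ k \<le> 2" by (simp add: k field_simps)
    qed (use N0 in simp)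
    finally show ?thesis unfolding Nk by simp
  qed
  have X: "(real d + 1) * 2 ^ d * real n / (real m)\<^sup>2 + real d * V \<le> 300 * (real d + 1) * 2 ^ d * N ^ k"
  proof -
    have "(N / 17)\<^sup>2 \<le> (real m)\<^sup>2" using m N0 by (intro power_mono) auto
    then have "(real d + 1) * 2 ^ d * real n / (real m)\<^sup>2 \<le> (real d + 1) * 2 ^ d * real n / (N / 17)\<^sup>2"
      using m N0 by (intro divide_left_mono) auto
    also have "\<dots> = 289 * ((real d + 1) * 2 ^ d * N ^ k)"
      using N0 by (simp add: nk field_simps power2_eq_square)
    finally have 1: "(real d + 1) * 2 ^ d * real n / (real m)\<^sup>2 \<le> 289 * ((real d + 1) * 2 ^ d * N ^ k)" .
    have "(N / 4) ^ k \<le> N ^ k" using N0 by (intro power_mono) auto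
    then have "V \<le> 4 * N ^ k" using V by linarith
    also have "\<dots> \<le> 2 ^ d * N ^ k" using N0 by (intro mult_right_mono) (auto simp: k power_add)
    finally have "real d * V \<le> (real d + 1) * (2 ^ d * N ^ k)"
      by (intro mult_mono) (auto simp: V0)
    then have "real d * V \<le> (real d + 1) * 2 ^ d * N ^ k" by (simp add: mult.assoc)
    moreover have "0 \<le> (real d + 1) * 2 ^ d * N ^ k" using N0 by simp
    ultimately show ?thesis using 1 by linarith
  qed
  have lnN: "ln (real n) \<le> real d * (2 * sqrt N)"
  proof -
    have "ln N = 2 * ln (sqrt N)" using N0 by (simp add: ln_sqrt)
    also have "\<dots> \<le> 2 * sqrt N" using ln_bound[of "sqrt N"] N0 by simp
    finally have "real d * ln N \<le> real d * (2 * sqrt N)" by (intro mult_left_mono) auto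
    then show ?thesis using N0 by (simp add: n[symmetric] ln_realpow)
  qed
  have Y: "300 * (real d + 1) * 2 ^ d * N ^ k * (real (d + 5) * ln (real n)) \<le> 2400 * N ^ (d - 1)"
  proof -
    have sN: "Q \<le> sqrt N" using NQ Q by (intro real_le_rsqrt)
    have nats: "d + 1 \<le> 2 ^ d" "d + 5 \<le> 4 * 2 ^ d" "d \<le> 2 ^ d"
    proof -
      show "d + 1 \<le> 2 ^ d" using less_exp[of d] by linarith
      then show "d \<le> 2 ^ d" by linarith
      have "k + 7 \<le> 16 * 2 ^ k" by (induction k) auto
      then show "d + 5 \<le> 4 * 2 ^ d" by (simp add: k)
    qed
    have "(d + 1) * (d + 5) * d \<le> 2 ^ d * (4 * 2 ^ d) * 2 ^ d" by (intro mult_le_mono nats)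
    then have "real ((d + 1) * (d + 5) * d) \<le> real (2 ^ d * (4 * 2 ^ d) * 2 ^ d)" by (rule of_nat_mono)
    also have "\<dots> = 4 * (2 * 2 * 2) ^ d" unfolding power_mult_distrib by simp
    \<comment> \<open>The base 15d is half of 30d, so that the remaining factor 2^d completes the
      power to Q.\<close>
    also have "\<dots> \<le> 4 * (15 * real d) ^ d" using d2 by (intro mult_left_mono power_mono) auto
    finally have poly: "(real d + 1) * real (d + 5) * real d \<le> 4 * (15 * real d) ^ d"
      by (simp only: of_nat_mult of_nat_add of_nat_1)
    have "300 * (real d + 1) * 2 ^ d * N ^ k * (real (d + 5) * ln (real n))
        \<le> 300 * (real d + 1) * 2 ^ d * N ^ k * (real (d + 5) * (real d * (2 * sqrt N)))"
      using N0 lnN by (intro mult_left_mono) auto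
    also have "\<dots> = 600 * ((real d + 1) * real (d + 5) * real d) * (2 ^ d * (sqrt N * N ^ k))"
      by (simp add: algebra_simps)
    also have "\<dots> \<le> 600 * (4 * (15 * real d) ^ d) * (2 ^ d * (sqrt N * N ^ k))"
      using poly N0 by (intro mult_right_mono mult_left_mono) auto
    also have "\<dots> = 2400 * (2 * (15 * real d)) ^ d * (sqrt N * N ^ k)"
      unfolding power_mult_distrib by (simp add: mult_ac)
    also have "\<dots> = 2400 * Q * (sqrt N * N ^ k)" by (simp add: Q_def)
    also have "\<dots> \<le> 2400 * sqrt N * (sqrt N * N ^ k)"
      using sN N0 by (intro mult_right_mono mult_left_mono) auto
    also have "\<dots> = 2400 * N ^ (d - 1)" using N0 unfolding Nk by (simp add: mult.assoc[symmetric])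
    finally show ?thesis .
  qed
  have "ln (real (p d n)) \<le> ((real d + 1) * 2 ^ d * real n / (real m)\<^sup>2 + real d * V) * (real (d + 5) * ln (real n))
      + 10 * (18 * real n / real m + real d * sqrt (V * real n))"
    unfolding V_def by (rule ln_p_le_of_params[OF d nd m(1)])
  also have "\<dots> \<le> 300 * (real d + 1) * 2 ^ d * N ^ k * (real (d + 5) * ln (real n))
      + 10 * (306 * N ^ (d - 1) + 4 * N ^ (d - 1))"
    using A B nd by (intro add_mono mult_right_mono X mult_left_mono) auto
  also have "\<dots> \<le> 5500 * N ^ (d - 1)" using Y by simp
  finally show ?thesis .
qed

section \<open>The lower bound\<close>

definition corner :: "nat \<Rightarrow> nat \<Rightarrow> (nat \<Rightarrow> nat) set" where
  "corner d k = {x \<in> lattice_pts d. (\<Sum>i<d. x i) < k}"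

lemma lattice_pts_Suc_iff: "x \<in> lattice_pts (Suc d) \<longleftrightarrow> x(d := 0) \<in> lattice_pts d"
proof
  assume x: "x \<in> lattice_pts (Suc d)"
  show "x(d := 0) \<in> lattice_pts d" unfolding lattice_pts_def
  proof (intro CollectI allI impI)
    fix i assume "d \<le> i"
    then show "(x(d := 0)) i = 0" using x by (cases "i = d") (auto simp: lattice_pts_def)
  qed
next
  assume x: "x(d := 0) \<in> lattice_pts d"
  show "x \<in> lattice_pts (Suc d)" unfolding lattice_pts_def
  proof (intro CollectI allI impI)
    fix i assume "Suc d \<le> i"
    then have "d \<le> i" "i \<noteq> d" by auto
    then show "x i = 0" using x by (auto simp: lattice_pts_def)
  qed
qed

lemma finite_corner [simp]: "finite (corner d k)"
proof (rule finite_subset)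
  show "corner d k \<subseteq> {f. \<forall>i. (i \<in> {..<d} \<longrightarrow> f i \<in> {..k}) \<and> (i \<notin> {..<d} \<longrightarrow> f i = 0)}"
  proof (intro subsetI CollectI allI conjI impI)
    fix x i assume x: "x \<in> corner d k"
    show "x i \<in> {..k}" if "i \<in> {..<d}"
      using member_le_sum[of i "{..<d}" x] that x by (simp add: corner_def)
    show "x i = 0" if "i \<notin> {..<d}" using that x by (simp add: corner_def lattice_pts_def)
  qed
  show "finite {f. \<forall>i. (i \<in> {..<d} \<longrightarrow> f i \<in> {..k}) \<and> (i \<notin> {..<d} \<longrightarrow> f i = 0)}"
    by (rule finite_set_of_finite_funs) auto
qed

lemma sum_upd_last: "(\<Sum>i<d. (x(d := c)) i) = (\<Sum>i<d. x i)" for d :: nat and x :: "nat \<Rightarrow> nat"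
  by (rule sum.cong) auto

text \<open>Pascal's rule: either the last coordinate vanishes, or lowering it by one gives a point
  of the next smaller simplex.\<close>

lemma card_corner_Suc_Suc: "card (corner (Suc d) (Suc k)) = card (corner d (Suc k)) + card (corner (Suc d) k)"
proof -
  let ?up = "\<lambda>x :: nat \<Rightarrow> nat. x(d := Suc (x d))"
  have "corner (Suc d) (Suc k) = corner d (Suc k) \<union> ?up ` corner (Suc d) k"
  proof (intro equalityI subsetI)
    fix x assume x: "x \<in> corner (Suc d) (Suc k)"
    show "x \<in> corner d (Suc k) \<union> ?up ` corner (Suc d) k"
    proof (cases "x d")
      case 0
      then have "x(d := 0) = x" by auto
      then have "x \<in> corner d (Suc k)" using x 0 by (simp add: corner_def lattice_pts_Suc_iff)
      then show ?thesis by simp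
    next
      case (Suc c)
      have "x = ?up (x(d := c))" using Suc by auto
      moreover have "x(d := c) \<in> corner (Suc d) k"
        using x Suc by (simp add: corner_def lattice_pts_Suc_iff sum_upd_last)
      ultimately show ?thesis by blast
    qed
  next
    fix x assume "x \<in> corner d (Suc k) \<union> ?up ` corner (Suc d) k"
    then show "x \<in> corner (Suc d) (Suc k)"
    proof
      assume x: "x \<in> corner d (Suc k)"
      then have "x d = 0" by (simp add: corner_def lattice_pts_def)
      then have "x(d := 0) = x" by auto
      then show ?thesis using x \<open>x d = 0\<close> by (simp add: corner_def lattice_pts_Suc_iff)
    next
      assume "x \<in> ?up ` corner (Suc d) k"
      then obtain y where "y \<in> corner (Suc d) k" "x = ?up y" by blast
      then show ?thesis by (simp add: corner_def lattice_pts_Suc_iff sum_upd_last)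
    qed
  qed
  moreover have "corner d (Suc k) \<inter> ?up ` corner (Suc d) k = {}"
    by (auto simp: corner_def lattice_pts_def)
  moreover have "inj ?up"
  proof (rule injI)
    fix x y assume eq: "?up x = ?up y"
    show "x = y"
    proof
      fix i show "x i = y i" using fun_cong[OF eq, of i] by (cases "i = d") auto
    qed
  qed
  ultimately show ?thesis
    by (simp add: card_Un_disjoint card_image inj_on_subset[OF _ subset_UNIV])
qed

lemma corner_zero: "corner d 0 = {}" "corner 0 (Suc k) = {\<lambda>_. 0}"
  by (auto simp: corner_def lattice_pts_def)

lemma card_corner: "card (corner d (Suc k)) = (k + d) choose d"
proof (induction d arbitrary: k)
  case 0 then show ?case by (simp add: corner_zero)
next
  case (Suc d)
  show ?case
  proof (induction k)
    case 0 then show ?case using Suc.IH[of 0] by (simp add: card_corner_Suc_Suc corner_zero)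
  next
    case (Suc k)
    then show ?case using Suc.IH \<open>\<And>k. card (corner d (Suc k)) = (k + d) choose d\<close>[of "Suc k"]
      by (simp add: card_corner_Suc_Suc)
  qed
qed

text \<open>The right-hand side is the rising factorial k (k+1) ... (k+d-1).\<close>

lemma power_le_fact_card_corner:
  assumes "k > 0"
  shows "k ^ d \<le> fact d * card (corner d k)"
proof -
  obtain j where Suc: "k = Suc j" using assms gr0_conv_Suc by blast
  have "Suc j ^ d \<le> fact d * ((j + d) choose d)"
  proof (induction d)
    case (Suc d)
    have "Suc j ^ Suc d \<le> Suc (j + d) * (fact d * ((j + d) choose d))"
      using Suc by (simp only: power_Suc, intro mult_le_mono) auto
    also have "\<dots> = fact d * (Suc (j + d) * ((j + d) choose d))" by (simp add: mult_ac)
    also have "Suc (j + d) * ((j + d) choose d) = Suc d * (Suc (j + d) choose Suc d)"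
      using Suc_times_binomial_eq[of "j + d" d] by (simp add: mult.commute)
    also have "fact d * (Suc d * (Suc (j + d) choose Suc d)) = fact (Suc d) * ((j + Suc d) choose Suc d)"
      by (simp only: fact_Suc of_nat_id add_Suc_right mult_ac)
    finally show ?case .
  qed simp
  then show ?thesis by (simp add: Suc card_corner)
qed

text \<open>The simplex in one more variable is the subgraph of the height k - |y|. Raising k by one
  adds one point above every y of the enlarged base, which is the recursion for
  \<open>corner\<close>.\<close>

lemma sum_height_corner:
  "(\<Sum>y\<in>corner d k. k - (\<Sum>i<d. y i)) = card (corner (Suc d) k)"
proof (induction k)
  case 0 then show ?case by (simp add: corner_zero)
next
  case (Suc k)
  have sub: "corner d k \<subseteq> corner d (Suc k)" by (auto simp: corner_def)
  have "(\<Sum>y\<in>corner d (Suc k). Suc k - (\<Sum>i<d. y i)) = (\<Sum>y\<in>corner d (Suc k). 1 + (k - (\<Sum>i<d. y i)))"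
    by (rule sum.cong) (auto simp: corner_def)
  also have "\<dots> = card (corner d (Suc k)) + (\<Sum>y\<in>corner d (Suc k). k - (\<Sum>i<d. y i))"
    unfolding sum.distrib by simp
  also have "(\<Sum>y\<in>corner d (Suc k). k - (\<Sum>i<d. y i)) = (\<Sum>y\<in>corner d k. k - (\<Sum>i<d. y i))"
    by (rule sum.mono_neutral_right[OF finite_corner sub]) (auto simp: corner_def)
  finally show ?case using Suc by (simp add: card_corner_Suc_Suc)
qed

section \<open>Lower sets from perturbed height functions\<close>

lemma finite_lower_sets: "finite {S. is_lower_set d S \<and> finite S \<and> card S = n}"
proof (rule finite_subset)
  let ?B = "{f. \<forall>i. (i \<in> {..<d} \<longrightarrow> f i \<in> {..<n}) \<and> (i \<notin> {..<d} \<longrightarrow> f i = 0)}"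
  show "{S. is_lower_set d S \<and> finite S \<and> card S = n} \<subseteq> Pow ?B"
  proof (intro subsetI PowI CollectI allI conjI impI)
    fix S x i assume S: "S \<in> {S. is_lower_set d S \<and> finite S \<and> card S = n}" and x: "x \<in> S"
    show "x i \<in> {..<n}" using lower_set_coord_less[of d S x i] S x by auto
    show "x i = 0" if "i \<notin> {..<d}" using lower_set_zero[of d S x i] S x that by auto
  qed
  have "finite ?B" by (rule finite_set_of_finite_funs) auto
  then show "finite (Pow ?B)" by simp
qed

text \<open>The sets counted here are the subgraphs of height functions that decrease with slope
  2 away from the origin, perturbed independently by 0, 1 or 2 at every other point; the height at
  the origin absorbs the points that are left over.\<close>
lemma three_power_le_p:
  assumes k: "k > 0" and n: "2 * card (corner (Suc e) k) + 2 * card (corner e k) \<le> n"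
  shows "3 ^ (card (corner e k) - 1) \<le> p (Suc e) n"
proof -
  define o' :: "nat \<Rightarrow> nat" where "o' = (\<lambda>_. 0)"
  define Y where "Y = corner e k"
  define X where "X = Y - {o'}"
  define s :: "(nat \<Rightarrow> nat) \<Rightarrow> nat" where "s y = (\<Sum>i<e. y i)" for y
  have oY: "o' \<in> Y" using k by (simp add: Y_def o'_def corner_def lattice_pts_def)
  have finY: "finite Y" "finite X" by (auto simp: Y_def X_def)
  have sY: "s y < k" "y \<in> lattice_pts e" if "y \<in> Y" for y using that by (auto simp: Y_def corner_def s_def)
  define g where "g h y = 2 * (k - s y) + h y" for h y
  define f where "f h y = (if y \<in> X then g h y else if y = o' then n - (\<Sum>y\<in>X. g h y) else 0)" for h y
  define G where "G h = {x \<in> lattice_pts (Suc e). x e < f h (x(e := 0))}" for h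
  define H where "H = X \<rightarrow>\<^sub>E {..<3 :: nat}"
  have h2: "h y \<le> 2" if "h \<in> H" "y \<in> X" for h y using that by (auto simp: H_def PiE_def Pi_def less_Suc_eq_le numeral_eq_Suc)
  \<comment> \<open>Even with all perturbations equal to 2, at least 2k + 2 points remain for the
    origin. No other height exceeds this, so the column at the origin is high enough.\<close>
  have tot: "(\<Sum>y\<in>X. g h y) + (2 * k + 2) \<le> n" if h: "h \<in> H" for h
  proof -
    have "(\<Sum>y\<in>X. g h y) \<le> (\<Sum>y\<in>X. 2 * (k - s y) + 2)"
      unfolding g_def using h2[OF h] by (intro sum_mono) auto
    moreover have "(\<Sum>y\<in>Y. 2 * (k - s y) + 2) = (2 * (k - s o') + 2) + (\<Sum>y\<in>X. 2 * (k - s y) + 2)"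
      unfolding X_def by (rule sum.remove[OF finY(1) oY])
    moreover have "s o' = 0" by (simp add: s_def o'_def)
    moreover have "(\<Sum>y\<in>Y. 2 * (k - s y) + 2) = 2 * card (corner (Suc e) k) + 2 * card (corner e k)"
      using sum_height_corner[of k e] unfolding sum.distrib sum_distrib_left[symmetric] Y_def s_def by simp
    ultimately show ?thesis using n by linarith
  qed
  have gk: "g h y \<le> 2 * k + 2" if "h \<in> H" "y \<in> X" for h y using h2[OF that] by (simp add: g_def)
  have fX: "f h y = g h y" if "y \<in> X" for h y using that by (simp add: f_def)
  have fo: "f h o' = n - (\<Sum>y\<in>X. g h y)" for h by (simp add: f_def X_def)
  have f_off: "f h y = 0" if "y \<notin> Y" for h y using that oY by (auto simp: f_def X_def)
  have card_G: "finite (G h) \<and> card (G h) = n" if h: "h \<in> H" for h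
  proof -
    let ?q = "\<lambda>(y :: nat \<Rightarrow> nat, c). y(e := c)"
    have eq: "G h = ?q ` (SIGMA y:Y. {..<f h y})"
    proof (intro equalityI subsetI)
      fix x assume x: "x \<in> G h"
      have "x(e := 0) \<in> Y" using x f_off[of "x(e := 0)" h] by (auto simp: G_def)
      then have "(x(e := 0), x e) \<in> (SIGMA y:Y. {..<f h y})" using x by (simp add: G_def)
      moreover have "x = ?q (x(e := 0), x e)" by simp
      ultimately show "x \<in> ?q ` (SIGMA y:Y. {..<f h y})" by (rule rev_image_eqI)
    next
      fix x assume "x \<in> ?q ` (SIGMA y:Y. {..<f h y})"
      then obtain y c where y: "y \<in> Y" "c < f h y" "x = y(e := c)" by auto
      have ye: "y(e := 0) = y" using sY(2)[OF y(1)] by (auto simp: lattice_pts_def fun_eq_iff)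
      then show "x \<in> G h" using y sY(2)[OF y(1)] by (simp add: G_def lattice_pts_Suc_iff)
    qed
    have inj: "inj_on ?q (SIGMA y:Y. {..<f h y})"
    proof (rule inj_onI, clarify, goal_cases)
      case (1 y c y' c')
      then have y: "y \<in> Y" "y' \<in> Y" and eq: "y(e := c) = y'(e := c')" by auto
      have "y l = y' l" for l
        using fun_cong[OF eq, of l] sY(2)[OF y(1)] sY(2)[OF y(2)] by (cases "l = e") (auto simp: lattice_pts_def)
      moreover have "c = c'" using fun_cong[OF eq, of e] by simp
      ultimately show ?case by auto
    qed
    have "card (G h) = (\<Sum>y\<in>Y. f h y)"
      unfolding eq card_image[OF inj] using finY by (simp add: card_SigmaI)
    also have "\<dots> = f h o' + (\<Sum>y\<in>X. f h y)" unfolding X_def by (rule sum.remove[OF finY(1) oY])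
    also have "(\<Sum>y\<in>X. f h y) = (\<Sum>y\<in>X. g h y)" by (rule sum.cong) (auto simp: fX)
    also have "f h o' + (\<Sum>y\<in>X. g h y) = n" using tot[OF h] by (simp add: fo)
    finally show ?thesis unfolding eq using finY by auto
  qed
  have f_mono: "f h y \<le> f h y'" if h: "h \<in> H" and y: "y \<in> lattice_pts e" "y' \<in> lattice_pts e"
      and le: "\<And>i. i < e \<Longrightarrow> y' i \<le> y i" for h y y'
  proof (cases "y \<in> X \<and> y \<noteq> y'")
    case False
    show ?thesis
    proof (cases "y = y'")
      case False
      with \<open>\<not> (y \<in> X \<and> y \<noteq> y')\<close> have nX: "y \<notin> X" by simp
      have "y \<noteq> o'"
      proof
        assume "y = o'"
        then have "y' i = y i" for i using le[of i] y by (cases "i < e") (auto simp: lattice_pts_def o'_def)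
        then show False using False by auto
      qed
      then show ?thesis using nX by (simp add: f_def)
    qed simp
  next
    case True
    have s_less: "s y' < s y"
    proof -
      have "\<exists>i<e. y' i < y i"
      proof (rule ccontr)
        assume "\<not> (\<exists>i<e. y' i < y i)"
        then have "y' i = y i" for i using le[of i] y by (cases "i < e") (auto simp: lattice_pts_def)
        then show False using True by auto
      qed
      then show ?thesis unfolding s_def using le by (intro sum_strict_mono_ex1) auto
    qed
    have yY: "y \<in> Y" using True by (simp add: X_def)
    show ?thesis
    proof (cases "y' = o'")
      case True
      have "g h y \<le> 2 * k + 2" using gk[OF h] \<open>y \<in> X \<and> y \<noteq> y'\<close> by simp
      also have "\<dots> \<le> f h o'" using tot[OF h] by (simp add: fo)
      finally show ?thesis using True \<open>y \<in> X \<and> y \<noteq> y'\<close> by (simp add: fX)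
    next
      case False
      have "y' \<in> Y" using s_less sY(1)[OF yY] y(2) by (simp add: Y_def corner_def s_def)
      then have X': "y' \<in> X" using False by (simp add: X_def)
      have "g h y \<le> 2 * (k - s y) + 2" using h2[OF h] True by (simp add: g_def)
      \<comment> \<open>Slope 2 is used here: |y'| < |y| gains at least 2, as much as the
        perturbation at y can take back.\<close>
      also have "\<dots> \<le> 2 * (k - s y')" using s_less sY(1)[OF yY] by linarith
      also have "\<dots> \<le> g h y'" by (simp add: g_def)
      finally show ?thesis using True X' by (simp add: fX)
    qed
  qed
  have lower_G: "is_lower_set (Suc e) (G h)" if h: "h \<in> H" for h
    unfolding is_lower_set_def
  proof (intro conjI ballI impI)
    show "G h \<subseteq> lattice_pts (Suc e)" by (auto simp: G_def)
    fix x x' assume x: "x \<in> G h" and x': "x' \<in> lattice_pts (Suc e)" and le: "\<forall>i<Suc e. x' i \<le> x i"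
    have "f h (x(e := 0)) \<le> f h (x'(e := 0))"
      by (rule f_mono[OF h]) (use x x' le in \<open>auto simp: G_def lattice_pts_Suc_iff[symmetric]\<close>)
    then have "x' e < f h (x'(e := 0))" using x le by (auto simp: G_def intro: le_less_trans less_le_trans)
    then show "x' \<in> G h" using x' by (simp add: G_def)
  qed
  have inj_G: "inj_on G H"
  proof (rule inj_onI)
    fix h h' assume h: "h \<in> H" "h' \<in> H" and eq: "G h = G h'"
    have le: "g h1 y \<le> g h2 y" if "G h1 = G h2" and y: "y \<in> X" for h1 h2 :: "(nat \<Rightarrow> nat) \<Rightarrow> nat" and y
    proof (rule ccontr)
      assume "\<not> g h1 y \<le> g h2 y"
      \<comment> \<open>The first free place above y in the lower of the two columns is occupied in
        the higher one, so the subgraph determines all heights on \<open>X\<close>.\<close>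
      define x where "x = y(e := g h2 y)"
      have yY: "y \<in> lattice_pts e" using y sY(2) by (simp add: X_def)
      then have ye: "y(e := 0) = y" by (auto simp: lattice_pts_def fun_eq_iff)
      have "x \<in> G h1" using \<open>\<not> g h1 y \<le> g h2 y\<close> yY ye y by (simp add: G_def x_def lattice_pts_Suc_iff fX)
      moreover have "x \<notin> G h2" using yY ye y by (simp add: G_def x_def fX)
      ultimately show False using that(1) by simp
    qed
    have "h y = h' y" if "y \<in> X" for y
      using le[OF eq that] le[OF eq[symmetric] that] by (simp add: g_def)
    then show "h = h'" using h unfolding H_def by (intro PiE_ext)
  qed
  have "card H \<le> p (Suc e) n" unfolding p_def
  proof (rule card_inj_on_le[OF inj_G _ finite_lower_sets])
    show "G ` H \<subseteq> {S. is_lower_set (Suc e) S \<and> finite S \<and> card S = n}"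
      using card_G lower_G by auto
  qed
  moreover have "card H = 3 ^ card X" unfolding H_def using finY by (simp add: card_PiE)
  moreover have "card X = card (corner e k) - 1" unfolding X_def using oY finY by (simp add: Y_def)
  ultimately show ?thesis by simp
qed

text \<open>Induction by Bernoulli's inequality (1 + 1/D)^D \<ge> 2. It bounds the side K of the
  simplex, given by (K/N)^d = d!/2, by N d/2.\<close>

lemma fact_le_two_half_power: "fact (k + 2) \<le> 2 * (real (k + 2) / 2) ^ (k + 2)"
proof (induction k)
  case 0 then show ?case by (simp add: fact_numeral)
next
  case (Suc k)
  define D where "D = real (k + 2)"
  have D: "D \<ge> 2" by (simp add: D_def)
  have "2 * D ^ (k + 2) \<le> (D + 1) ^ (k + 2)"
  proof -
    have "2 = 1 + real (k + 2) * (1 / D)" using D by (simp add: D_def)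
    also have "\<dots> \<le> (1 + 1 / D) ^ (k + 2)" by (rule Bernoulli_inequality, rule order_trans[of _ 0]) (use D in simp_all)
    finally have "2 * D ^ (k + 2) \<le> (1 + 1 / D) ^ (k + 2) * D ^ (k + 2)"
      using D by (intro mult_right_mono) auto
    also have "\<dots> = ((1 + 1 / D) * D) ^ (k + 2)" by (simp only: power_mult_distrib)
    also have "(1 + 1 / D) * D = D + 1" using D by (simp add: field_simps)
    finally show ?thesis .
  qed
  then have *: "2 * (D / 2) ^ (k + 2) \<le> ((D + 1) / 2) ^ (k + 2)"
    unfolding power_divide times_divide_eq_right by (intro divide_right_mono) auto
  have "fact (Suc k + 2) = (D + 1) * fact (k + 2)" by (simp add: D_def algebra_simps)
  also have "\<dots> \<le> (D + 1) * (2 * (D / 2) ^ (k + 2))"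
    using Suc D by (intro mult_left_mono) (auto simp: D_def)
  also have "\<dots> \<le> (D + 1) * ((D + 1) / 2) ^ (k + 2)" using * D by (intro mult_left_mono) auto
  also have "\<dots> = 2 * ((D + 1) / 2) ^ Suc (k + 2)" by simp
  also have "\<dots> = 2 * (real (Suc k + 2) / 2) ^ (Suc k + 2)" by (simp only: D_def) simp
  finally show ?case .
qed

text \<open>The bound ln x \<ge> 1 - 1/x is too weak at 3 but sharp enough at 3/e, which is close to
  1.\<close>

lemma ln_three_ge: "ln (3 :: real) \<ge> 109 / 100"
proof -
  have "1 - 1 / (3 / exp 1) \<le> ln (3 / exp 1 :: real)"
    using ln_le_minus_one[of "exp 1 / 3 :: real"] by (simp add: ln_div)
  moreover have "ln (3 / exp 1 :: real) = ln 3 - 1" by (simp add: ln_div)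
  ultimately show ?thesis using e_less_272 by simp
qed

text \<open>The side K makes the subgraph of slope 2 have volume 2 K^d/d! = n. Its base then has
  volume K^(d-1)/(d-1)!, at least N^(d-1). Rounding K down and discarding the origin cost at most 2
  percent, and 0.98 * 1.09 > 1 still holds.\<close>

lemma ln_p_lower:
  fixes N :: real
  assumes d: "d \<ge> 2" and n: "N ^ d = real n" and N: "N \<ge> (30 * real d) ^ (2 * d)"
  shows "ln (real (p d n)) > N ^ (d - 1)"
proof -
  obtain e where e: "d = Suc e" "e \<ge> 1" using d by (metis One_nat_def Suc_1 Suc_le_D Suc_le_mono)
  have d2: "real d \<ge> 2" using d by simp
  have "(900 * (real d)\<^sup>2)\<^sup>2 = (30 * real d) ^ 4" by (simp add: power_mult_distrib)
  also have "\<dots> \<le> (30 * real d) ^ (2 * d)" using d d2 by (intro power_increasing) auto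
  finally have N1: "N \<ge> (900 * (real d)\<^sup>2)\<^sup>2" using N by simp
  have d4: "(real d)\<^sup>2 \<ge> 4" using power_mono[of 2 "real d" 2] d2 by simp
  have "900 * (real d)\<^sup>2 * 1 \<le> (900 * (real d)\<^sup>2)\<^sup>2"
    unfolding power2_eq_square[of "900 * (real d)\<^sup>2"] using d4 by (intro mult_left_mono) auto
  then have N2: "N \<ge> 900 * (real d)\<^sup>2" using N1 by simp
  have N0: "N \<ge> 3600" using N2 d4 by linarith
  define K where "K = root d (fact d / 2 * real n)"
  have Kd: "K ^ d = fact d / 2 * real n" unfolding K_def using d by (intro real_root_pow_pos2) auto
  have f2: "(fact d :: real) \<ge> 2"
  proof -
    have "(fact 2 :: real) \<le> fact d" using d by (intro fact_mono)
    then show ?thesis by (simp add: fact_numeral)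
  qed
  have K0: "K \<ge> 0" unfolding K_def by (intro real_root_ge_zero) simp
  have KN: "K \<ge> N"
  proof -
    have "1 * N ^ d \<le> fact d / 2 * N ^ d" using f2 N0 by (intro mult_right_mono) auto
    then have "N ^ d \<le> K ^ d" using Kd n by simp
    then show ?thesis using K0 d by (intro power_le_imp_le_base[of N "d - 1" K]) auto
  qed
  have KN': "K \<le> N * (real d / 2)"
  proof -
    have "fact d \<le> 2 * (real d / 2) ^ d" using fact_le_two_half_power[of "d - 2"] unfolding le_add_diff_inverse2[OF d] .
    then have "fact d / 2 * N ^ d \<le> (real d / 2) ^ d * N ^ d" using N0 by (intro mult_right_mono) auto
    then have "K ^ d \<le> (N * (real d / 2)) ^ d" unfolding power_mult_distrib using Kd n by (simp add: mult.commute)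
    then show ?thesis using K0 N0 d by (intro power_le_imp_le_base[of K "d - 1" "N * (real d / 2)"]) auto
  qed
  \<comment> \<open>Divide K * K^e = (d!/2) N^d by the upper bound N d/2 for K: an upper bound on
    the side yields a lower bound on the base.\<close>
  have Ke: "K ^ e \<ge> fact e * N ^ e"
  proof -
    have "N * (real d / 2) * (fact e * N ^ e) = fact d / 2 * N ^ d" by (simp add: e(1) algebra_simps)
    also have "\<dots> = K * K ^ e" using Kd n by (simp add: e(1))
    also have "\<dots> \<le> N * (real d / 2) * K ^ e" using KN' K0 by (intro mult_right_mono) auto
    finally show ?thesis using N0 d2 by (simp add: mult_le_cancel_left_pos)
  qed
  \<comment> \<open>Subtracting d makes room for the lattice correction and the perturbations: the
    total number of points is at most 2 (k + d choose d) \<le> 2 (k + d)^d/d! \<le> n.\<close>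
  define k where "k = nat \<lfloor>K\<rfloor> - d"
  have "real d \<le> (real d)\<^sup>2" using d2 by (simp add: power2_eq_square)
  then have dK: "real d + 2 \<le> K" using KN N2 d2 by linarith
  have kK: "real k + real d \<le> K" "real k \<ge> K - (real d + 1)" "k > 0"
    using dK unfolding k_def by linarith+
  have vol: "2 * card (corner (Suc e) k) + 2 * card (corner e k) \<le> n"
  proof -
    obtain j where j: "k = Suc j" using kK(3) gr0_conv_Suc by blast
    have "card (corner (Suc e) k) + card (corner e k) \<le> (k + d) choose d"
    proof -
      have "card (corner e k) \<le> (k + e) choose e"
        unfolding j card_corner by (cases e) simp_all
      moreover have "card (corner (Suc e) k) = (k + e) choose Suc e" unfolding j card_corner by simp
      ultimately show ?thesis by (simp add: e(1))
    qed
    then have "real (2 * card (corner (Suc e) k) + 2 * card (corner e k)) \<le> 2 * real ((k + d) choose d)" by linarith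
    also have "real ((k + d) choose d) * fact d \<le> real ((k + d) ^ d)"
      using of_nat_mono[OF binomial_fact_pow[of "k + d" d]] by (metis of_nat_fact of_nat_mult)
    then have "2 * real ((k + d) choose d) \<le> 2 * (real k + real d) ^ d / fact d"
      by (simp add: field_simps)
    also have "\<dots> \<le> 2 * K ^ d / fact d" using kK(1) by (intro divide_right_mono mult_left_mono power_mono) auto
    also have "\<dots> = real n" by (simp add: Kd)
    finally show ?thesis by (simp only: of_nat_le_iff)
  qed
  define L where "L = card (corner e k)"
  have "real (fact e * L) \<ge> real (k ^ e)" unfolding L_def
    using power_le_fact_card_corner[OF kK(3)] by (rule of_nat_mono)
  then have L1: "fact e * real L \<ge> real k ^ e" by simp
  have "real k ^ e \<ge> 99 / 100 * K ^ e"
  proof -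
    \<comment> \<open>The relative loss from K to k. By Bernoulli the e-th power loses at most e t
      \<le> 1/100, because K is at least 900 d^2.\<close>
    define t where "t = (real d + 1) / K"
    have K1: "K > 0" using KN N0 by linarith
    have t: "t \<le> 1" unfolding t_def using dK K1 by simp
    have "real e * (real d + 1) \<le> (real d)\<^sup>2"
      by (simp add: e(1) power2_eq_square algebra_simps)
    then have "real e * (real d + 1) \<le> K / 100" using KN N2 d4 by linarith
    then have "real e * t \<le> 1 / 100" unfolding t_def using K1 by (simp add: field_simps)
    moreover have "1 + real e * (- t) \<le> (1 + (- t)) ^ e" by (rule Bernoulli_inequality) (use t in simp)
    ultimately have "99 / 100 \<le> (1 - t) ^ e" by simp
    then have "99 / 100 * K ^ e \<le> (1 - t) ^ e * K ^ e" using K0 by (intro mult_right_mono) auto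
    also have "\<dots> = ((1 - t) * K) ^ e" by (simp only: power_mult_distrib)
    also have "(1 - t) * K = K - (real d + 1)" unfolding t_def using K1 by (simp add: left_diff_distrib)
    also have "(K - (real d + 1)) ^ e \<le> real k ^ e" using kK dK by (intro power_mono) auto
    finally show ?thesis .
  qed
  then have "fact e * (99 / 100 * N ^ e) \<le> fact e * real L" using Ke L1 by linarith
  then have L2: "real L \<ge> 99 / 100 * N ^ e" by (simp add: mult_le_cancel_left_pos)
  have "N \<le> N ^ e" using N0 e(2) by (intro self_le_power) auto
  then have NE: "N ^ e \<ge> 3600" using N0 by linarith
  then have "L \<ge> 1" using L2 by linarith
  then have L3: "real (L - 1) \<ge> 98 / 100 * N ^ e" using L2 NE by (simp add: of_nat_diff)
  have "3 ^ (L - 1) \<le> p d n" using three_power_le_p[OF kK(3) vol] unfolding L_def e(1) .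
  then have "real (3 ^ (L - 1)) \<le> real (p d n)" by (rule of_nat_mono)
  then have "ln ((3::real) ^ (L - 1)) \<le> ln (real (p d n))" by (intro ln_mono) auto
  then have "real (L - 1) * ln 3 \<le> ln (real (p d n))" by (simp add: ln_realpow)
  moreover have "98 / 100 * N ^ e * (109 / 100) \<le> real (L - 1) * ln 3"
    using L3 ln_three_ge NE by (intro mult_mono) auto
  ultimately have "N ^ e < ln (real (p d n))" using NE by linarith
  then show ?thesis by (simp add: e(1))
qed

theorem theorem1:
  fixes d n :: nat
  assumes "d \<ge> 2" and "real n \<ge> (30 * real d) ^ (2 * d ^ 2)"
  shows "1 < ln (real (p d n)) / real n powr (1 - 1 / real d) \<and>
         ln (real (p d n)) / real n powr (1 - 1 / real d) < 7200"
proof -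
  define N where "N = root d (real n)"
  have d: "d > 0" using assms(1) by simp
  have Nd: "N ^ d = real n" unfolding N_def using d by (intro real_root_pow_pos2) auto
  have le: "((30 * real d) ^ (2 * d)) ^ d \<le> N ^ d"
    using assms(2) unfolding Nd power_mult[symmetric] by (simp only: power2_eq_square mult.assoc)
  have N0: "N \<ge> 0" unfolding N_def by (intro real_root_ge_zero) simp
  have N: "N \<ge> (30 * real d) ^ (2 * d)"
    using power_strict_mono[OF _ N0 d, of "(30 * real d) ^ (2 * d)"] le by (meson not_le)
  moreover have "(30 * real d) ^ (2 * d) > 0" using d by simp
  ultimately have Npos: "N > 0" by linarith
  have "real n powr (1 - 1 / real d) = N powr (real d * (1 - 1 / real d))"
    unfolding Nd[symmetric] powr_realpow[OF Npos, symmetric] powr_powr ..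
  also have "real d * (1 - 1 / real d) = real (d - 1)" using d by (simp add: field_simps of_nat_diff)
  also have "N powr real (d - 1) = N ^ (d - 1)" by (rule powr_realpow[OF Npos])
  finally have eq: "real n powr (1 - 1 / real d) = N ^ (d - 1)" .
  have "N ^ (d - 1) > 0" using Npos by simp
  then show ?thesis
    unfolding eq using ln_p_lower[OF assms(1) Nd N] ln_p_upper[OF assms(1) Nd N]
    by (simp add: field_simps)
qed

end
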